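(* A complete list of $\mathrm{Inn}(\mathfrak{aff}_2(\mathbb R))$-inequivalent proper subalgebras of the real rank-two affine Lie algebra $\mathfrak{aff}_2(\mathbb R)$ (that is, every proper subalgebra is $\mathrm{Inn}(\mathfrak{aff}_2(\mathbb R))$-equivalent to exactly one subalgebra of the list) is given by 1D: $\mathfrak s_{1.1}=\langle f_1\rangle$, $\mathfrak s_{1.2}^{\delta}=\langle e_1+\delta f_1\rangle$, $\mathfrak s_{1.3}=\langle e_4\rangle$, $\mathfrak s_{1.4}^\kappa=\langle e_2+\kappa e_4\rangle$, $\mathfrak s_{1.5}=\langle e_2+e_4+f_2\rangle$, $\mathfrak s_{1.6}^\varepsilon=\langle e_1+\varepsilon e_4\rangle$, $\mathfrak s_{1.7}^\gamma=\langle e_1+e_3+\gamma e_4\rangle$; 2D: $\mathfrak s_{2.1}=\langle f_1,f_2\rangle$, $\mathfrak s_{2.2}^{\delta}=\langle e_1+\delta f_1,f_2\rangle$, $\mathfrak s_{2.3}=\langle e_4,f_1\rangle$, $\mathfrak s_{2.4}^\kappa=\langle e_2+\kappa e_4,f_1\rangle$, $\mathfrak s_{2.5}^{\kappa'}=\langle e_2+\kappa' e_4,f_2\rangle$, $\mathfrak s_{2.6}=\langle e_2+e_4+f_2,f_1\rangle$, $\mathfrak s_{2.7}^\varepsilon=\langle e_1+\varepsilon e_4,f_2\rangle$, $\mathfrak s_{2.8}=\langle e_1,e_4\rangle$, $\mathfrak s_{2.9}=\langle e_2,e_4\rangle$, $\mathfrak s_{2.10}=\langle e_1+e_3,e_4\rangle$,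 $\mathfrak s_{2.11}^\gamma=\langle e_2+\gamma e_4,e_1\rangle$, $\mathfrak s_{2.12}=\langle e_2+e_4+f_2,e_1\rangle$, $\mathfrak s_{2.13}=\langle e_2-3e_4,e_1+f_1\rangle$; 3D: $\mathfrak s_{3.1}=\langle e_1,f_1,f_2\rangle$, $\mathfrak s_{3.2}=\langle e_4,f_1,f_2\rangle$, $\mathfrak s_{3.3}^\kappa=\langle e_2+\kappa e_4,f_1,f_2\rangle$, $\mathfrak s_{3.4}^\varepsilon=\langle e_1+\varepsilon e_4,f_1,f_2\rangle$, $\mathfrak s_{3.5}^\gamma=\langle e_1+e_3+\gamma e_4,f_1,f_2\rangle$, $\mathfrak s_{3.6}=\langle e_1,e_4,f_2\rangle$, $\mathfrak s_{3.7}=\langle e_2,e_4,f_1\rangle$, $\mathfrak s_{3.8}^\gamma=\langle e_2+\gamma e_4,e_1,f_2\rangle$, $\mathfrak s_{3.9}=\langle e_2-e_4+f_1,e_1,f_2\rangle$, $\mathfrak s_{3.10}=\langle e_2-3e_4,e_1+f_1,f_2\rangle$, $\mathfrak s_{3.11}=\langle e_1,e_2,e_4\rangle$, $\mathfrak s_{3.12}=\langle e_1,e_2,e_3\rangle$; 4D: $\mathfrak s_{4.1}=\langle e_1,e_4,f_1,f_2\rangle$, $\mathfrak s_{4.2}=\langle e_2,e_4,f_1,f_2\rangle$, $\mathfrak s_{4.3}=\langle e_1+e_3,e_4,f_1,f_2\rangle$, $\mathfrak s_{4.4}^\gamma=\langle e_2+\gamma e_4,e_1,f_1,f_2\rangle$,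 $\mathfrak s_{4.5}=\langle e_1,e_2,e_4,f_2\rangle$, $\mathfrak s_{4.6}=\langle e_1,e_2,e_3,e_4\rangle$; 5D: $\mathfrak s_{5.1}=\langle e_1,e_2,e_4,f_1,f_2\rangle$, $\mathfrak s_{5.2}=\langle e_1,e_2,e_3,f_1,f_2\rangle$; where $\varepsilon\in\{-1,1\}$, $\delta\in\{0,1\}$, $\kappa\geqslant0$, $\kappa'>0$ and $\gamma\in\mathbb R$ (different parameter values within a family give different entries of the list).
   Context: $\mathfrak{aff}_2(\mathbb R)=\mathfrak{gl}_2(\mathbb R)\ltimes\mathbb R^2$, where $\mathfrak{gl}_2(\mathbb R)$ acts on the abelian Lie algebra $\mathbb R^2$ by matrix–vector multiplication, i.e. $[(A,v),(B,w)]=(AB-BA,\,Aw-Bv)$. The basis is $$e_1=\begin{pmatrix}0&0\\1&0\end{pmatrix},\ e_2=\tfrac12\begin{pmatrix}1&0\\0&-1\end{pmatrix},\ e_3=\begin{pmatrix}0&-1\\0&0\end{pmatrix},\ e_4=\tfrac12\begin{pmatrix}1&0\\0&1\end{pmatrix},\ f_1=\begin{pmatrix}1\\0\end{pmatrix},\ f_2=\begin{pmatrix}0\\1\end{pmatrix}.$$ $\langle\cdots\rangle$ denotes the real linear span. $\mathrm{Inn}(\mathfrak{aff}_2(\mathbb R))$ is the group of inner automorphisms, i.e. the image of the adjoint action of the connected group $\mathrm{GL}_2^+(\mathbb R)\ltimes\mathbb R^2$ (with $\mathrm{GL}^+_2(\mathbb R)$ the matrices of positive determinant). Two subalgebras are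 equivalent if one is mapped onto the other by an element of this group. "Proper" means different from $\{0\}$ and from the whole algebra. *)

theory Defs
  imports "HOL-Analysis.Analysis"
begin

text \<open>The pair \<open>(A, v)\<close> stands for the element of the semidirect sum with linear
  part \<open>A\<close> (a matrix given by its rows) and translational part \<open>v\<close>.\<close>

type_synonym aff2 = "(real ^ 2 ^ 2) \<times> (real ^ 2)"

definition bracket :: "aff2 \<Rightarrow> aff2 \<Rightarrow> aff2" where
  "bracket X Y = (fst X ** fst Y - fst Y ** fst X, fst X *v snd Y - fst Y *v snd X)"

definition subalgebra :: "aff2 set \<Rightarrow> bool" where
  "subalgebra S \<longleftrightarrow> subspace S \<and> (\<forall>X\<in>S. \<forall>Y\<in>S. bracket X Y \<in> S)"

definition proper_subalgebra :: "aff2 set \<Rightarrow> bool" where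
  "proper_subalgebra S \<longleftrightarrow> subalgebra S \<and> S \<noteq> {0} \<and> S \<noteq> UNIV"

text \<open>The pair \<open>(g, u)\<close> is the affine map \<open>x \<mapsto> g x + u\<close>. Embedding \<open>(g, u)\<close> and \<open>(A, v)\<close>
  as the block matrices with rows \<open>g u | 0 1\<close> and \<open>A v | 0 0\<close>, the adjoint action is
  conjugation of matrices, which gives the formula for \<open>Ad\<close>; see \<open>block_Ad\<close> below.\<close>

definition aff_group :: "((real ^ 2 ^ 2) \<times> (real ^ 2)) set" where
  "aff_group = {(g, u). det g > 0}"

definition Ad :: "(real ^ 2 ^ 2) \<times> (real ^ 2) \<Rightarrow> aff2 \<Rightarrow> aff2" where
  "Ad p X = (let g = fst p; u = snd p; A = fst X; v = snd X; B = g ** A ** matrix_inv g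
             in (B, g *v v - B *v u))"

definition Inn :: "(aff2 \<Rightarrow> aff2) set" where
  "Inn = Ad ` aff_group"

definition equivalent :: "aff2 set \<Rightarrow> aff2 set \<Rightarrow> bool" where
  "equivalent S T \<longleftrightarrow> (\<exists>\<phi>\<in>Inn. \<phi> ` S = T)"

definition block :: "real \<Rightarrow> (real ^ 2 ^ 2) \<times> (real ^ 2) \<Rightarrow> real ^ 3 ^ 3" where
  "block c X = vector [vector [fst X $ 1 $ 1, fst X $ 1 $ 2, snd X $ 1],
                       vector [fst X $ 2 $ 1, fst X $ 2 $ 2, snd X $ 2],
                       vector [0, 0, c]]"

lemma block_mult:
  "block c X ** block d Y = block (c * d) (fst X ** fst Y, fst X *v snd Y + d *\<^sub>R snd X)"
  by (simp add: block_def vec_eq_iff forall_3 sum_3 sum_2 matrix_matrix_mult_def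
      matrix_vector_mult_def algebra_simps)

lemma block_bracket: "block 0 (bracket X Y) = block 0 X ** block 0 Y - block 0 Y ** block 0 X"
  unfolding block_mult by (simp add: block_def bracket_def vec_eq_iff forall_3)

lemma block_Ad:
  assumes "p \<in> aff_group"
  shows "block 0 (Ad p X) ** block 1 p = block 1 p ** block 0 X"
proof -
  have "invertible (fst p)"
    using assms by (auto simp: aff_group_def invertible_det_nz)
  then have "matrix_inv (fst p) ** fst p = mat 1"
    unfolding invertible_def matrix_inv_def by (rule someI2_ex) simp
  then show ?thesis
    unfolding block_mult by (simp add: Ad_def Let_def flip: matrix_mul_assoc)
qed

definition e\<^sub>1 :: aff2 where "e\<^sub>1 = (vector [vector [0, 0], vector [1, 0]], 0)"
definition e\<^sub>2 :: aff2 where "e\<^sub>2 = ((1/2) *\<^sub>R vector [vector [1, 0], vector [0, -1]], 0)"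
definition e\<^sub>3 :: aff2 where "e\<^sub>3 = (vector [vector [0, -1], vector [0, 0]], 0)"
definition e\<^sub>4 :: aff2 where "e\<^sub>4 = ((1/2) *\<^sub>R vector [vector [1, 0], vector [0, 1]], 0)"
definition f\<^sub>1 :: aff2 where "f\<^sub>1 = (0, vector [1, 0])"
definition f\<^sub>2 :: aff2 where "f\<^sub>2 = (0, vector [0, 1])"

text \<open>One constructor per family, applied to its parameter if it has one. Comparing labels
  rather than subspaces keeps entries with different parameter values apart.\<close>

datatype label =
    S1_1 | S1_2 real | S1_3 | S1_4 real | S1_5 | S1_6 real | S1_7 real
  | S2_1 | S2_2 real | S2_3 | S2_4 real | S2_5 real | S2_6 | S2_7 real | S2_8 | S2_9 | S2_10 | S2_11 real | S2_12 | S2_13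
  | S3_1 | S3_2 | S3_3 real | S3_4 real | S3_5 real | S3_6 | S3_7 | S3_8 real | S3_9 | S3_10 | S3_11 | S3_12
  | S4_1 | S4_2 | S4_3 | S4_4 real | S4_5 | S4_6
  | S5_1 | S5_2

definition labels_1D :: "label set" where
  "labels_1D = {S1_1, S1_3, S1_5}
    \<union> S1_2 ` {0, 1}
    \<union> S1_4 ` {0..}
    \<union> S1_6 ` {-1, 1}
    \<union> S1_7 ` UNIV"

definition labels_2D :: "label set" where
  "labels_2D = {S2_1, S2_3, S2_6, S2_8, S2_9, S2_10, S2_12, S2_13}
    \<union> S2_2 ` {0, 1}
    \<union> S2_4 ` {0..}
    \<union> S2_5 ` {0<..}
    \<union> S2_7 ` {-1, 1}
    \<union> S2_11 ` UNIV"

definition labels_3D :: "label set" where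
  "labels_3D = {S3_1, S3_2, S3_6, S3_7, S3_9, S3_10, S3_11, S3_12}
    \<union> S3_3 ` {0..}
    \<union> S3_4 ` {-1, 1}
    \<union> S3_5 ` UNIV
    \<union> S3_8 ` UNIV"

definition labels_4D :: "label set" where
  "labels_4D = {S4_1, S4_2, S4_3, S4_5, S4_6}
    \<union> S4_4 ` UNIV"

definition labels_5D :: "label set" where
  "labels_5D = {S5_1, S5_2}"

definition labels :: "label set" where
  "labels = labels_1D \<union> labels_2D \<union> labels_3D \<union> labels_4D \<union> labels_5D"

primrec subalg :: "label \<Rightarrow> aff2 set" where
    "subalg S1_1 = span {f\<^sub>1}"
  | "subalg (S1_2 \<delta>) = span {e\<^sub>1 + \<delta> *\<^sub>R f\<^sub>1}"
  | "subalg S1_3 = span {e\<^sub>4}"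
  | "subalg (S1_4 \<kappa>) = span {e\<^sub>2 + \<kappa> *\<^sub>R e\<^sub>4}"
  | "subalg S1_5 = span {e\<^sub>2 + e\<^sub>4 + f\<^sub>2}"
  | "subalg (S1_6 \<epsilon>) = span {e\<^sub>1 + \<epsilon> *\<^sub>R e\<^sub>4}"
  | "subalg (S1_7 \<gamma>) = span {e\<^sub>1 + e\<^sub>3 + \<gamma> *\<^sub>R e\<^sub>4}"
  | "subalg S2_1 = span {f\<^sub>1, f\<^sub>2}"
  | "subalg (S2_2 \<delta>) = span {e\<^sub>1 + \<delta> *\<^sub>R f\<^sub>1, f\<^sub>2}"
  | "subalg S2_3 = span {e\<^sub>4, f\<^sub>1}"
  | "subalg (S2_4 \<kappa>) = span {e\<^sub>2 + \<kappa> *\<^sub>R e\<^sub>4, f\<^sub>1}"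
  | "subalg (S2_5 \<kappa>') = span {e\<^sub>2 + \<kappa>' *\<^sub>R e\<^sub>4, f\<^sub>2}"
  | "subalg S2_6 = span {e\<^sub>2 + e\<^sub>4 + f\<^sub>2, f\<^sub>1}"
  | "subalg (S2_7 \<epsilon>) = span {e\<^sub>1 + \<epsilon> *\<^sub>R e\<^sub>4, f\<^sub>2}"
  | "subalg S2_8 = span {e\<^sub>1, e\<^sub>4}"
  | "subalg S2_9 = span {e\<^sub>2, e\<^sub>4}"
  | "subalg S2_10 = span {e\<^sub>1 + e\<^sub>3, e\<^sub>4}"
  | "subalg (S2_11 \<gamma>) = span {e\<^sub>2 + \<gamma> *\<^sub>R e\<^sub>4, e\<^sub>1}"
  | "subalg S2_12 = span {e\<^sub>2 + e\<^sub>4 + f\<^sub>2, e\<^sub>1}"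
  | "subalg S2_13 = span {e\<^sub>2 - 3 *\<^sub>R e\<^sub>4, e\<^sub>1 + f\<^sub>1}"
  | "subalg S3_1 = span {e\<^sub>1, f\<^sub>1, f\<^sub>2}"
  | "subalg S3_2 = span {e\<^sub>4, f\<^sub>1, f\<^sub>2}"
  | "subalg (S3_3 \<kappa>) = span {e\<^sub>2 + \<kappa> *\<^sub>R e\<^sub>4, f\<^sub>1, f\<^sub>2}"
  | "subalg (S3_4 \<epsilon>) = span {e\<^sub>1 + \<epsilon> *\<^sub>R e\<^sub>4, f\<^sub>1, f\<^sub>2}"
  | "subalg (S3_5 \<gamma>) = span {e\<^sub>1 + e\<^sub>3 + \<gamma> *\<^sub>R e\<^sub>4, f\<^sub>1, f\<^sub>2}"
  | "subalg S3_6 = span {e\<^sub>1, e\<^sub>4, f\<^sub>2}"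
  | "subalg S3_7 = span {e\<^sub>2, e\<^sub>4, f\<^sub>1}"
  | "subalg (S3_8 \<gamma>) = span {e\<^sub>2 + \<gamma> *\<^sub>R e\<^sub>4, e\<^sub>1, f\<^sub>2}"
  | "subalg S3_9 = span {e\<^sub>2 - e\<^sub>4 + f\<^sub>1, e\<^sub>1, f\<^sub>2}"
  | "subalg S3_10 = span {e\<^sub>2 - 3 *\<^sub>R e\<^sub>4, e\<^sub>1 + f\<^sub>1, f\<^sub>2}"
  | "subalg S3_11 = span {e\<^sub>1, e\<^sub>2, e\<^sub>4}"
  | "subalg S3_12 = span {e\<^sub>1, e\<^sub>2, e\<^sub>3}"
  | "subalg S4_1 = span {e\<^sub>1, e\<^sub>4, f\<^sub>1, f\<^sub>2}"
  | "subalg S4_2 = span {e\<^sub>2, e\<^sub>4, f\<^sub>1, f\<^sub>2}"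
  | "subalg S4_3 = span {e\<^sub>1 + e\<^sub>3, e\<^sub>4, f\<^sub>1, f\<^sub>2}"
  | "subalg (S4_4 \<gamma>) = span {e\<^sub>2 + \<gamma> *\<^sub>R e\<^sub>4, e\<^sub>1, f\<^sub>1, f\<^sub>2}"
  | "subalg S4_5 = span {e\<^sub>1, e\<^sub>2, e\<^sub>4, f\<^sub>2}"
  | "subalg S4_6 = span {e\<^sub>1, e\<^sub>2, e\<^sub>3, e\<^sub>4}"
  | "subalg S5_1 = span {e\<^sub>1, e\<^sub>2, e\<^sub>4, f\<^sub>1, f\<^sub>2}"
  | "subalg S5_2 = span {e\<^sub>1, e\<^sub>2, e\<^sub>3, f\<^sub>1, f\<^sub>2}"

end

theory Submission imports Defs begin

text \<open>A subalgebra \<open>S\<close> is described by the projection \<open>Q\<close> of its linear part to trace-free matrices,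
  by whether it contains a dilation, by its translations \<open>V\<close>, and by the lifts of \<open>Q\<close> to \<open>S\<close>, which
  form a cocycle modulo \<open>V\<close>. Conjugation brings \<open>Q\<close> into one of six forms: if \<open>Q\<close> is commutative,
  it is zero or a line, classified by the sign of the discriminant of a generator; otherwise a
  commutator \<open>N\<close> of two elements is orthogonal to both for the trace form, so either \<open>N\<close> has nonzero
  discriminant and \<open>Q\<close> is everything, or all commutators are nilpotent and \<open>Q\<close> is triangular.
  If \<open>V\<close> is a line, it is spanned by a common eigenvector. The remaining freedom is the
  choice of the lifts: a translation removes coboundaries and a diagonal matrix
  rescales what is left. Conversely, the entries of the list are separated by
  \<open>dim S\<close>, \<open>V\<close>, the presence of a dilation, the splitting of the cocycle, and traces
  of suitably normalized elements.\<close>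

section \<open>Coordinates\<close>

text \<open>The exceptional entries are resonances. The element
  \<open>e\<^sub>2 + c e\<^sub>4\<close> acts on \<open>f\<^sub>1\<close>, \<open>f\<^sub>2\<close>
  and \<open>e\<^sub>1\<close> with the eigenvalues \<open>(c + 1) / 2\<close>,
  \<open>(c - 1) / 2\<close> and \<open>- 1\<close>. A translation removes every component of its
  lift that belongs to a nonzero eigenvalue, so a component can survive only along
  \<open>f\<^sub>1\<close> for \<open>c = - 1\<close> or along \<open>f\<^sub>2\<close> for
  \<open>c = 1\<close>; hence \<open>S1_5\<close>, \<open>S2_6\<close>, \<open>S2_12\<close> and
  \<open>S3_9\<close>. A lift \<open>e\<^sub>1 + p f\<^sub>1\<close> of \<open>e\<^sub>1\<close> is
  compatible with the bracket for \<open>p \<noteq> 0\<close> only if the eigenvalues of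
  \<open>e\<^sub>1\<close> and \<open>f\<^sub>1\<close> agree, that is
  \<open>(c + 1) / 2 = - 1\<close>; hence the number \<open>- 3\<close> in \<open>S2_13\<close> and
  \<open>S3_10\<close>. The group contains no reflections, so \<open>\<epsilon>\<close> and the sign
  of \<open>\<gamma>\<close> in the elliptic families cannot be changed. The quarter turn maps
  \<open>e\<^sub>2\<close> to \<open>- e\<^sub>2\<close> and exchanges the axes. It makes
  \<open>c\<close> nonnegative for a hyperbolic line, and this uses up the freedom to choose between
  the axes: an invariant line of translations leads to the two families \<open>S2_4\<close> and
  \<open>S2_5\<close>, which meet only at the parameter 0.\<close>

definition mat2 :: "real \<Rightarrow> real \<Rightarrow> real \<Rightarrow> real \<Rightarrow> real ^ 2 ^ 2" where
  "mat2 a b c d = vector [vector [a, b], vector [c, d]]"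

text \<open>Coordinates with respect to the basis \<open>e\<^sub>1, e\<^sub>2, e\<^sub>3, e\<^sub>4,
  f\<^sub>1, f\<^sub>2\<close>; in them, questions about subspaces become linear equations, and
  \<open>x4\<close> is the trace of the linear part.\<close>

definition elt :: "real \<Rightarrow> real \<Rightarrow> real \<Rightarrow> real \<Rightarrow> real \<Rightarrow> real \<Rightarrow> aff2" where
  "elt x1 x2 x3 x4 y1 y2 = (mat2 ((x4 + x2) / 2) (- x3) x1 ((x4 - x2) / 2), vector [y1, y2])"

lemma mat2_nth [simp]:
  "mat2 a b c d $ 1 $ 1 = a" "mat2 a b c d $ 1 $ 2 = b" "mat2 a b c d $ 2 $ 1 = c" "mat2 a b c d $ 2 $ 2 = d"
  by (simp_all add: mat2_def)

lemma elt_exhaust: obtains x1 x2 x3 x4 y1 y2 where "X = elt x1 x2 x3 x4 y1 y2"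
proof
  show "X = elt (fst X $ 2 $ 1) (fst X $ 1 $ 1 - fst X $ 2 $ 2) (- fst X $ 1 $ 2)
      (fst X $ 1 $ 1 + fst X $ 2 $ 2) (snd X $ 1) (snd X $ 2)"
    by (simp add: elt_def prod_eq_iff vec_eq_iff forall_2)
qed

lemma elt_eq_iff [simp]:
  "elt x1 x2 x3 x4 y1 y2 = elt x1' x2' x3' x4' y1' y2' \<longleftrightarrow>
    x1 = x1' \<and> x2 = x2' \<and> x3 = x3' \<and> x4 = x4' \<and> y1 = y1' \<and> y2 = y2'"
  by (auto simp: elt_def prod_eq_iff vec_eq_iff forall_2 field_simps)

lemma elt_0: "0 = elt 0 0 0 0 0 0"
  by (simp add: elt_def prod_eq_iff vec_eq_iff forall_2)

lemma elt_eq_0_iff [simp]: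
  "elt x1 x2 x3 x4 y1 y2 = 0 \<longleftrightarrow> x1 = 0 \<and> x2 = 0 \<and> x3 = 0 \<and> x4 = 0 \<and> y1 = 0 \<and> y2 = 0"
  by (simp add: elt_0)

lemma elt_add [simp]:
  "elt x1 x2 x3 x4 y1 y2 + elt x1' x2' x3' x4' y1' y2' =
    elt (x1 + x1') (x2 + x2') (x3 + x3') (x4 + x4') (y1 + y1') (y2 + y2')"
  by (simp add: elt_def prod_eq_iff vec_eq_iff forall_2 field_simps)

lemma elt_diff [simp]:
  "elt x1 x2 x3 x4 y1 y2 - elt x1' x2' x3' x4' y1' y2' =
    elt (x1 - x1') (x2 - x2') (x3 - x3') (x4 - x4') (y1 - y1') (y2 - y2')"
  by (simp add: elt_def prod_eq_iff vec_eq_iff forall_2 field_simps)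

lemma elt_scaleR [simp]:
  "k *\<^sub>R elt x1 x2 x3 x4 y1 y2 = elt (k * x1) (k * x2) (k * x3) (k * x4) (k * y1) (k * y2)"
  by (simp add: elt_def prod_eq_iff vec_eq_iff forall_2 field_simps)

lemma elt_basis:
  "e\<^sub>1 = elt 1 0 0 0 0 0" "e\<^sub>2 = elt 0 1 0 0 0 0" "e\<^sub>3 = elt 0 0 1 0 0 0"
  "e\<^sub>4 = elt 0 0 0 1 0 0" "f\<^sub>1 = elt 0 0 0 0 1 0" "f\<^sub>2 = elt 0 0 0 0 0 1"
  by (simp_all add: e\<^sub>1_def e\<^sub>2_def e\<^sub>3_def e\<^sub>4_def f\<^sub>1_def f\<^sub>2_def elt_def prod_eq_iff vec_eq_iff forall_2)

lemma bracket_elt [simp]: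
  "bracket (elt x1 x2 x3 x4 y1 y2) (elt x1' x2' x3' x4' y1' y2') =
    elt (x1 * x2' - x2 * x1') (2 * (x1 * x3' - x3 * x1')) (x2 * x3' - x3 * x2') 0
      ((x4 + x2) / 2 * y1' - x3 * y2' - (x4' + x2') / 2 * y1 + x3' * y2)
      (x1 * y1' + (x4 - x2) / 2 * y2' - x1' * y1 - (x4' - x2') / 2 * y2)"
  by (simp add: bracket_def elt_def prod_eq_iff vec_eq_iff forall_2 matrix_matrix_mult_def
      matrix_vector_mult_def sum_2 field_simps)

text \<open>Replaces each span by its linear equations, so that closure under the bracket,
  invariants and equivalences are all checked by arithmetic on coordinates.\<close>

lemma mem_subalg [simp]:
  "elt x1 x2 x3 x4 y1 y2 \<in> subalg S1_1 \<longleftrightarrow> x1 = 0 \<and> x2 = 0 \<and> x3 = 0 \<and> x4 = 0 \<and> y2 = 0"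
  "elt x1 x2 x3 x4 y1 y2 \<in> subalg (S1_2 a) \<longleftrightarrow> x2 = 0 \<and> x3 = 0 \<and> x4 = 0 \<and> y1 = a * x1 \<and> y2 = 0"
  "elt x1 x2 x3 x4 y1 y2 \<in> subalg S1_3 \<longleftrightarrow> x1 = 0 \<and> x2 = 0 \<and> x3 = 0 \<and> y1 = 0 \<and> y2 = 0"
  "elt x1 x2 x3 x4 y1 y2 \<in> subalg (S1_4 a) \<longleftrightarrow> x1 = 0 \<and> x3 = 0 \<and> x4 = a * x2 \<and> y1 = 0 \<and> y2 = 0"
  "elt x1 x2 x3 x4 y1 y2 \<in> subalg S1_5 \<longleftrightarrow> x1 = 0 \<and> x3 = 0 \<and> x4 = x2 \<and> y1 = 0 \<and> y2 = x2"
  "elt x1 x2 x3 x4 y1 y2 \<in> subalg (S1_6 a) \<longleftrightarrow> x2 = 0 \<and> x3 = 0 \<and> x4 = a * x1 \<and> y1 = 0 \<and> y2 = 0"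
  "elt x1 x2 x3 x4 y1 y2 \<in> subalg (S1_7 a) \<longleftrightarrow> x2 = 0 \<and> x3 = x1 \<and> x4 = a * x1 \<and> y1 = 0 \<and> y2 = 0"
  "elt x1 x2 x3 x4 y1 y2 \<in> subalg S2_1 \<longleftrightarrow> x1 = 0 \<and> x2 = 0 \<and> x3 = 0 \<and> x4 = 0"
  "elt x1 x2 x3 x4 y1 y2 \<in> subalg (S2_2 a) \<longleftrightarrow> x2 = 0 \<and> x3 = 0 \<and> x4 = 0 \<and> y1 = a * x1"
  "elt x1 x2 x3 x4 y1 y2 \<in> subalg S2_3 \<longleftrightarrow> x1 = 0 \<and> x2 = 0 \<and> x3 = 0 \<and> y2 = 0"
  "elt x1 x2 x3 x4 y1 y2 \<in> subalg (S2_4 a) \<longleftrightarrow> x1 = 0 \<and> x3 = 0 \<and> x4 = a * x2 \<and> y2 = 0"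
  "elt x1 x2 x3 x4 y1 y2 \<in> subalg (S2_5 a) \<longleftrightarrow> x1 = 0 \<and> x3 = 0 \<and> x4 = a * x2 \<and> y1 = 0"
  "elt x1 x2 x3 x4 y1 y2 \<in> subalg S2_6 \<longleftrightarrow> x1 = 0 \<and> x3 = 0 \<and> x4 = x2 \<and> y2 = x2"
  "elt x1 x2 x3 x4 y1 y2 \<in> subalg (S2_7 a) \<longleftrightarrow> x2 = 0 \<and> x3 = 0 \<and> x4 = a * x1 \<and> y1 = 0"
  "elt x1 x2 x3 x4 y1 y2 \<in> subalg S2_8 \<longleftrightarrow> x2 = 0 \<and> x3 = 0 \<and> y1 = 0 \<and> y2 = 0"
  "elt x1 x2 x3 x4 y1 y2 \<in> subalg S2_9 \<longleftrightarrow> x1 = 0 \<and> x3 = 0 \<and> y1 = 0 \<and> y2 = 0"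
  "elt x1 x2 x3 x4 y1 y2 \<in> subalg S2_10 \<longleftrightarrow> x2 = 0 \<and> x3 = x1 \<and> y1 = 0 \<and> y2 = 0"
  "elt x1 x2 x3 x4 y1 y2 \<in> subalg (S2_11 a) \<longleftrightarrow> x3 = 0 \<and> x4 = a * x2 \<and> y1 = 0 \<and> y2 = 0"
  "elt x1 x2 x3 x4 y1 y2 \<in> subalg S2_12 \<longleftrightarrow> x3 = 0 \<and> x4 = x2 \<and> y1 = 0 \<and> y2 = x2"
  "elt x1 x2 x3 x4 y1 y2 \<in> subalg S2_13 \<longleftrightarrow> x3 = 0 \<and> x4 = - 3 * x2 \<and> y1 = x1 \<and> y2 = 0"
  "elt x1 x2 x3 x4 y1 y2 \<in> subalg S3_1 \<longleftrightarrow> x2 = 0 \<and> x3 = 0 \<and> x4 = 0"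
  "elt x1 x2 x3 x4 y1 y2 \<in> subalg S3_2 \<longleftrightarrow> x1 = 0 \<and> x2 = 0 \<and> x3 = 0"
  "elt x1 x2 x3 x4 y1 y2 \<in> subalg (S3_3 a) \<longleftrightarrow> x1 = 0 \<and> x3 = 0 \<and> x4 = a * x2"
  "elt x1 x2 x3 x4 y1 y2 \<in> subalg (S3_4 a) \<longleftrightarrow> x2 = 0 \<and> x3 = 0 \<and> x4 = a * x1"
  "elt x1 x2 x3 x4 y1 y2 \<in> subalg (S3_5 a) \<longleftrightarrow> x2 = 0 \<and> x3 = x1 \<and> x4 = a * x1"
  "elt x1 x2 x3 x4 y1 y2 \<in> subalg S3_6 \<longleftrightarrow> x2 = 0 \<and> x3 = 0 \<and> y1 = 0"
  "elt x1 x2 x3 x4 y1 y2 \<in> subalg S3_7 \<longleftrightarrow> x1 = 0 \<and> x3 = 0 \<and> y2 = 0"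
  "elt x1 x2 x3 x4 y1 y2 \<in> subalg (S3_8 a) \<longleftrightarrow> x3 = 0 \<and> x4 = a * x2 \<and> y1 = 0"
  "elt x1 x2 x3 x4 y1 y2 \<in> subalg S3_9 \<longleftrightarrow> x3 = 0 \<and> x4 = - x2 \<and> y1 = x2"
  "elt x1 x2 x3 x4 y1 y2 \<in> subalg S3_10 \<longleftrightarrow> x3 = 0 \<and> x4 = - 3 * x2 \<and> y1 = x1"
  "elt x1 x2 x3 x4 y1 y2 \<in> subalg S3_11 \<longleftrightarrow> x3 = 0 \<and> y1 = 0 \<and> y2 = 0"
  "elt x1 x2 x3 x4 y1 y2 \<in> subalg S3_12 \<longleftrightarrow> x4 = 0 \<and> y1 = 0 \<and> y2 = 0"
  "elt x1 x2 x3 x4 y1 y2 \<in> subalg S4_1 \<longleftrightarrow> x2 = 0 \<and> x3 = 0"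
  "elt x1 x2 x3 x4 y1 y2 \<in> subalg S4_2 \<longleftrightarrow> x1 = 0 \<and> x3 = 0"
  "elt x1 x2 x3 x4 y1 y2 \<in> subalg S4_3 \<longleftrightarrow> x2 = 0 \<and> x3 = x1"
  "elt x1 x2 x3 x4 y1 y2 \<in> subalg (S4_4 a) \<longleftrightarrow> x3 = 0 \<and> x4 = a * x2"
  "elt x1 x2 x3 x4 y1 y2 \<in> subalg S4_5 \<longleftrightarrow> x3 = 0 \<and> y1 = 0"
  "elt x1 x2 x3 x4 y1 y2 \<in> subalg S4_6 \<longleftrightarrow> y1 = 0 \<and> y2 = 0"
  "elt x1 x2 x3 x4 y1 y2 \<in> subalg S5_1 \<longleftrightarrow> x3 = 0"
  "elt x1 x2 x3 x4 y1 y2 \<in> subalg S5_2 \<longleftrightarrow> x4 = 0"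
  by (auto simp: elt_basis span_breakdown_eq algebra_simps)

declare subalg.simps [simp del]

lemma subspace_subalg: "subspace (subalg l)"
  by (cases l) (simp_all add: subalg.simps)

lemma bracket_subalg:
  assumes "X \<in> subalg l" "Y \<in> subalg l" shows "bracket X Y \<in> subalg l"
  using assms
  by (cases X rule: elt_exhaust; cases Y rule: elt_exhaust; cases l) (auto simp: field_simps)

lemma dim_subalg:
  "l \<in> labels_1D \<Longrightarrow> dim (subalg l) = 1"
  "l \<in> labels_2D \<Longrightarrow> dim (subalg l) = 2"
  "l \<in> labels_3D \<Longrightarrow> dim (subalg l) = 3"
  "l \<in> labels_4D \<Longrightarrow> dim (subalg l) = 4"
  "l \<in> labels_5D \<Longrightarrow> dim (subalg l) = 5"
  by (auto simp: labels_1D_def labels_2D_def labels_3D_def labels_4D_def labels_5D_def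
    subalg.simps elt_basis dim_insert span_breakdown_eq)

lemma proper_subalgebra_subalg:
  assumes "l \<in> labels" shows "proper_subalgebra (subalg l)"
proof -
  have "dim (subalg l) \<in> {1..5}"
    using assms by (auto simp: labels_def dim_subalg)
  moreover have "dim (UNIV :: aff2 set) = 6"
    by (simp add: DIM_prod)
  ultimately have "subalg l \<noteq> {0}" "subalg l \<noteq> UNIV"
    by force+
  then show ?thesis
    using subspace_subalg bracket_subalg by (auto simp: proper_subalgebra_def subalgebra_def)
qed

section \<open>The adjoint action\<close>

text \<open>These are the two components of the block identity \<open>Ad p X * p = p * X\<close>.
  They determine \<open>Ad p X\<close> (see \<open>Ad_eqI\<close>), so no matrix inverse has to be
  computed from here on.\<close>

lemma Ad_spec:
  assumes "det g \<noteq> 0"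
  shows "fst (Ad (g, u) X) ** g = g ** fst X"
    and "snd (Ad (g, u) X) = g *v snd X - fst (Ad (g, u) X) *v u"
proof -
  have "invertible g" using assms by (simp add: invertible_det_nz)
  then have "matrix_inv g ** g = mat 1"
    unfolding invertible_def matrix_inv_def by (rule someI2_ex) simp
  then show "fst (Ad (g, u) X) ** g = g ** fst X"
    by (simp add: Ad_def Let_def flip: matrix_mul_assoc)
  show "snd (Ad (g, u) X) = g *v snd X - fst (Ad (g, u) X) *v u"
    by (simp add: Ad_def Let_def)
qed

lemma matrix_mult_right_cancel:
  fixes g :: "real ^ 'n ^ 'n"
  assumes "det g \<noteq> 0" "A ** g = B ** g"
  shows "A = B"
proof -
  obtain h where "g ** h = mat 1"
    using assms(1) by (auto simp: invertible_def simp flip: invertible_det_nz)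
  then show ?thesis
    using arg_cong[OF assms(2), of "\<lambda>C. C ** h"] by (simp flip: matrix_mul_assoc)
qed

lemma Ad_eqI:
  assumes "det g \<noteq> 0" "fst Y ** g = g ** fst X" "snd Y = g *v snd X - fst Y *v u"
  shows "Ad (g, u) X = Y"
proof -
  have "fst (Ad (g, u) X) = fst Y"
    using Ad_spec(1)[OF assms(1), of u X] assms(1,2) by (metis matrix_mult_right_cancel)
  then show ?thesis
    using Ad_spec(2)[OF assms(1), of u X] assms(3) by (simp add: prod_eq_iff)
qed

text \<open>The pair on the right is the composite affine map
  \<open>x -> g (h x + v) + u\<close>.\<close>

lemma Ad_Ad:
  assumes "det g \<noteq> 0" "det h \<noteq> 0"
  shows "Ad (g, u) (Ad (h, v) X) = Ad (g ** h, g *v v + u) X"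
proof (rule sym, rule Ad_eqI)
  let ?Y = "Ad (h, v) X" let ?Z = "Ad (g, u) ?Y"
  note Y = Ad_spec[OF assms(2), of v X] and Z = Ad_spec[OF assms(1), of u ?Y]
  show "det (g ** h) \<noteq> 0" using assms by (simp add: det_mul)
  show "fst ?Z ** (g ** h) = g ** h ** fst X"
    by (simp add: matrix_mul_assoc Z(1)) (simp add: Y(1) flip: matrix_mul_assoc)
  show "snd ?Z = g ** h *v snd X - fst ?Z *v (g *v v + u)"
    by (simp add: Z Y matrix_vector_mult_diff_distrib matrix_vector_right_distrib
        matrix_vector_mul_assoc)
qed

lemma Ad_id: "Ad (mat 1, 0) X = X"
  by (rule Ad_eqI) simp_all

lemma aff_groupI: "det g > 0 \<Longrightarrow> (g, u) \<in> aff_group"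
  by (simp add: aff_group_def)

lemma Ad_inverse:
  assumes "p \<in> aff_group"
  obtains q where "q \<in> aff_group" "\<And>X. Ad q (Ad p X) = X" "\<And>X. Ad p (Ad q X) = X"
proof -
  obtain g u where p: "p = (g, u)" and g: "det g > 0"
    using assms by (auto simp: aff_group_def)
  then obtain h where h: "g ** h = mat 1" "h ** g = mat 1"
    by (metis invertible_def invertible_det_nz less_irrefl)
  from h(1) have "det g * det h = 1"
    by (metis det_I det_mul)
  with g have det_h: "det h > 0"
    by (metis zero_less_mult_pos zero_less_one)
  show ?thesis
  proof
    \<comment> \<open>This pair is the inverse of the affine map
      \<open>x -> g x + u\<close>.\<close>
    show "(h, - (h *v u)) \<in> aff_group" using det_h by (rule aff_groupI)
    show "Ad (h, - (h *v u)) (Ad p X) = X" for X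
      using g det_h by (simp add: p Ad_Ad h Ad_id)
    show "Ad p (Ad (h, - (h *v u)) X) = X" for X
      using g det_h
      by (simp add: p Ad_Ad h Ad_id matrix_vector_mul_assoc vec.neg)
  qed
qed

lemma equivalent_trans:
  assumes "equivalent S T" "equivalent T U" shows "equivalent S U"
proof -
  obtain g u where 1: "det g > 0" "Ad (g, u) ` S = T"
    using assms(1) by (auto simp: equivalent_def Inn_def aff_group_def)
  obtain h v where 2: "det h > 0" "Ad (h, v) ` T = U"
    using assms(2) by (auto simp: equivalent_def Inn_def aff_group_def)
  have "Ad (h ** g, h *v u + v) ` S = U"
    using 1(1) 2(1) by (simp add: image_image Ad_Ad flip: 1(2) 2(2))
  moreover have "(h ** g, h *v u + v) \<in> aff_group"
    using 1(1) 2(1) by (simp add: aff_group_def det_mul)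
  ultimately show ?thesis
    unfolding equivalent_def Inn_def by blast
qed

lemma equivalent_Ad: "p \<in> aff_group \<Longrightarrow> equivalent S (Ad p ` S)"
  by (auto simp: equivalent_def Inn_def)

lemma matrix_distribs:
  fixes A B C :: "real ^ 'n ^ 'n"
  shows "(A + B) ** C = A ** C + B ** C" "(A - B) ** C = A ** C - B ** C"
    "C ** (A + B) = C ** A + C ** B" "C ** (A - B) = C ** A - C ** B"
  by (simp_all add: vec_eq_iff matrix_matrix_mult_def sum.distrib sum_subtractf algebra_simps)

lemma matrix_scaleR_left_right:
  fixes A B :: "real ^ 'n ^ 'n"
  shows "(k *\<^sub>R A) ** B = k *\<^sub>R (A ** B)" "A ** (k *\<^sub>R B) = k *\<^sub>R (A ** B)"
  by (simp_all add: vec_eq_iff matrix_matrix_mult_def sum_distrib_left algebra_simps)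

lemma linear_Ad: "linear (Ad p)"
  by (rule linearI)
     (simp_all add: Ad_def Let_def prod_eq_iff matrix_distribs matrix_scaleR_left_right
      scaleR_right_diff_distrib algebra_simps flip: scaleR_matrix_vector_assoc)

lemma bracket_Ad:
  assumes "p \<in> aff_group"
  shows "bracket (Ad p X) (Ad p Y) = Ad p (bracket X Y)"
proof -
  obtain g u where p: "p = (g, u)" and g: "det g \<noteq> 0"
    using assms by (auto simp: aff_group_def)
  note X = Ad_spec[OF g, of u X] and Y = Ad_spec[OF g, of u Y]
  have mult: "fst (Ad (g, u) X) ** fst (Ad (g, u) Y) ** g = g ** (fst X ** fst Y)"
    if "fst (Ad (g, u) X) ** g = g ** fst X" "fst (Ad (g, u) Y) ** g = g ** fst Y" for X Y
    by (simp add: that(2) flip: matrix_mul_assoc) (simp add: that(1) matrix_mul_assoc)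
  have "Ad (g, u) (bracket X Y) = bracket (Ad (g, u) X) (Ad (g, u) Y)"
  proof (rule Ad_eqI[OF g])
    show "fst (bracket (Ad (g, u) X) (Ad (g, u) Y)) ** g = g ** fst (bracket X Y)"
      using mult[OF X(1) Y(1)] mult[OF Y(1) X(1)]
      by (simp add: bracket_def matrix_distribs)
    show "snd (bracket (Ad (g, u) X) (Ad (g, u) Y)) =
        g *v snd (bracket X Y) - fst (bracket (Ad (g, u) X) (Ad (g, u) Y)) *v u"
      by (simp add: bracket_def X Y matrix_vector_mult_diff_distrib matrix_vector_mult_diff_rdistrib
          matrix_vector_mul_assoc algebra_simps)
  qed
  then show ?thesis by (simp add: p)
qed

lemma det_mat2 [simp]: "det (mat2 a b c d) = a * d - b * c"
  by (simp add: det_2)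

text \<open>The triple \<open>x1, x2, x3\<close> consists of the coefficients of the quadratic form
  \<open>v -> det (v, A v) = x1 v1^2 - x2 v1 v2 + x3 v2^2\<close>. Conjugation by \<open>g\<close>
  turns this form into \<open>D\<close> times its composite with the inverse of \<open>g\<close>,
  which gives the three fractions.\<close>

lemma Ad_elt:
  fixes a b c d x1 x2 x3 :: real
  defines "D \<equiv> a * d - b * c"
  assumes "D \<noteq> 0"
  defines "x1' \<equiv> (d\<^sup>2 * x1 + c * d * x2 + c\<^sup>2 * x3) / D"
    and "x2' \<equiv> (2 * b * d * x1 + (a * d + b * c) * x2 + 2 * a * c * x3) / D"
    and "x3' \<equiv> (b\<^sup>2 * x1 + a * b * x2 + a\<^sup>2 * x3) / D"
  shows "Ad (mat2 a b c d, vector [u1, u2]) (elt x1 x2 x3 x4 y1 y2) =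
    elt x1' x2' x3' x4 (a * y1 + b * y2 - (x4 + x2') / 2 * u1 + x3' * u2)
      (c * y1 + d * y2 - x1' * u1 - (x4 - x2') / 2 * u2)"
proof (rule Ad_eqI)
  have x': "D * x1' = d\<^sup>2 * x1 + c * d * x2 + c\<^sup>2 * x3"
    "D * x2' = 2 * b * d * x1 + (a * d + b * c) * x2 + 2 * a * c * x3"
    "D * x3' = b\<^sup>2 * x1 + a * b * x2 + a\<^sup>2 * x3"
    using assms(2) by (simp_all add: x1'_def x2'_def x3'_def)
  \<comment> \<open>The identities 1 to 4 are the four entries of \<open>A' g = g A\<close>, where
    \<open>A'\<close> is the new linear part, after the contributions of the trace \<open>x4\<close>
    have been cancelled.\<close>
  have "D * (a * x2' / 2 - c * x3') = a * (D * x2') / 2 - c * (D * x3')"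
    by (simp add: algebra_simps)
  also have "\<dots> = D * (a * x2 / 2 + b * x1)"
    unfolding x' unfolding D_def by (simp add: field_simps power2_eq_square)
  finally have 1: "a * x2' / 2 - c * x3' = a * x2 / 2 + b * x1"
    using assms(2) by simp
  have "D * (b * x2' / 2 - d * x3') = b * (D * x2') / 2 - d * (D * x3')"
    by (simp add: algebra_simps)
  also have "\<dots> = D * (- a * x3 - b * x2 / 2)"
    unfolding x' unfolding D_def by (simp add: field_simps power2_eq_square)
  finally have 2: "b * x2' / 2 - d * x3' = - a * x3 - b * x2 / 2"
    using assms(2) by simp
  have "D * (a * x1' - c * x2' / 2) = a * (D * x1') - c * (D * x2') / 2"
    by (simp add: algebra_simps)
  also have "\<dots> = D * (c * x2 / 2 + d * x1)"
    unfolding x' unfolding D_def by (simp add: field_simps power2_eq_square)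
  finally have 3: "a * x1' - c * x2' / 2 = c * x2 / 2 + d * x1"
    using assms(2) by simp
  have "D * (b * x1' - d * x2' / 2) = b * (D * x1') - d * (D * x2') / 2"
    by (simp add: algebra_simps)
  also have "\<dots> = D * (- c * x3 - d * x2 / 2)"
    unfolding x' unfolding D_def by (simp add: field_simps power2_eq_square)
  finally have 4: "b * x1' - d * x2' / 2 = - c * x3 - d * x2 / 2"
    using assms(2) by simp
  show "fst (elt x1' x2' x3' x4 (a * y1 + b * y2 - (x4 + x2') / 2 * u1 + x3' * u2)
      (c * y1 + d * y2 - x1' * u1 - (x4 - x2') / 2 * u2)) ** mat2 a b c d =
    mat2 a b c d ** fst (elt x1 x2 x3 x4 y1 y2)"
    using 1 2 3 4
    by (simp add: elt_def vec_eq_iff forall_2 matrix_matrix_mult_def sum_2; intro conjI; argo)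
qed (use assms in \<open>simp_all add: elt_def vec_eq_iff forall_2 matrix_vector_mult_def sum_2\<close>)

lemma subalgebra_Ad:
  assumes "p \<in> aff_group" "subalgebra S" shows "subalgebra (Ad p ` S)"
  using assms by (auto simp: subalgebra_def bracket_Ad linear_Ad linear_subspace_image)

lemma equivalent_sym:
  assumes "equivalent S T" shows "equivalent T S"
proof -
  obtain p where p: "p \<in> aff_group" and T: "T = Ad p ` S"
    using assms by (auto simp: equivalent_def Inn_def)
  obtain q where "q \<in> aff_group" "\<And>X. Ad q (Ad p X) = X"
    using Ad_inverse[OF p] by metis
  then show ?thesis
    unfolding T using equivalent_Ad[of q "Ad p ` S"] by (simp add: image_image)
qed

section \<open>Invariants of subalgebras\<close>

text \<open>Discriminant of the characteristic polynomial, and also of the form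
  \<open>v -> wedge v (A v)\<close>. It depends only on the trace-free part of \<open>A\<close>; its
  sign separates hyperbolic, nilpotent and elliptic generators.\<close>

definition disc :: "aff2 \<Rightarrow> real" where
  "disc X = (trace (fst X))\<^sup>2 - 4 * det (fst X)"

definition wedge :: "real ^ 2 \<Rightarrow> real ^ 2 \<Rightarrow> real" where
  "wedge v w = v $ 1 * w $ 2 - v $ 2 * w $ 1"

text \<open>Conjugation by a matrix of positive determinant preserves the sign of the quadratic form
  \<open>v \<mapsto> wedge v (A v)\<close>. This orientation invariant separates the values of \<open>\<epsilon>\<close>
  and the signs of \<open>\<gamma>\<close> in the nilpotent and elliptic families.\<close>

definition pos_form :: "aff2 \<Rightarrow> bool" where
  "pos_form X \<longleftrightarrow> (\<forall>v. wedge v (fst X *v v) \<ge> 0) \<and> (\<exists>v. wedge v (fst X *v v) > 0)"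

lemma Ad_0_iff: "p \<in> aff_group \<Longrightarrow> Ad p X = 0 \<longleftrightarrow> X = 0"
  by (metis Ad_inverse linear_Ad linear_0)

lemma fst_Ad_mult:
  assumes "(g, u) \<in> aff_group" shows "fst (Ad (g, u) X) ** g = g ** fst X"
  using assms by (simp add: aff_group_def Ad_spec)

text \<open>Scalar matrices commute with \<open>g\<close>.\<close>

lemma fst_Ad_scalar:
  assumes "p \<in> aff_group" "fst X = k *\<^sub>R mat 1" shows "fst (Ad p X) = k *\<^sub>R mat 1"
proof -
  obtain g u where p: "p = (g, u)" "det g \<noteq> 0" using assms(1) by (auto simp: aff_group_def)
  have "fst (Ad p X) ** g = (k *\<^sub>R mat 1) ** g"
    using assms by (simp add: p(1) fst_Ad_mult matrix_scaleR_left_right)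
  then show ?thesis using p(2) by (rule matrix_mult_right_cancel[rotated])
qed

lemma trace_Ad:
  assumes "p \<in> aff_group" shows "trace (fst (Ad p X)) = trace (fst X)"
proof -
  obtain g u where p: "p = (g, u)" "det g \<noteq> 0" using assms(1) by (auto simp: aff_group_def)
  then obtain h where h: "g ** h = mat 1" "h ** g = mat 1"
    by (auto simp: invertible_def simp flip: invertible_det_nz)
  have "fst (Ad p X) = g ** fst X ** h"
    using assms h by (metis fst_Ad_mult p(1) matrix_mul_assoc matrix_mul_rid)
  then show ?thesis
    using h by (metis trace_mul_sym matrix_mul_assoc matrix_mul_lid)
qed

lemma det_Ad:
  assumes "p \<in> aff_group" shows "det (fst (Ad p X)) = det (fst X)"
proof -
  obtain g u where p: "p = (g, u)" "det g \<noteq> 0" using assms(1) by (auto simp: aff_group_def)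
  then have "det (fst (Ad p X)) * det g = det g * det (fst X)"
    using assms by (simp add: fst_Ad_mult flip: det_mul)
  then show ?thesis using p(2) by simp
qed

lemma disc_Ad: "p \<in> aff_group \<Longrightarrow> disc (Ad p X) = disc X"
  by (simp add: disc_def trace_Ad det_Ad)

lemma wedge_mult: "wedge (g *v v) (g *v w) = det g * wedge v w"
  by (simp add: wedge_def det_2 matrix_vector_mult_def sum_2 algebra_simps)

text \<open>Every vector is of the form \<open>g v\<close>, and the form of \<open>Ad p X\<close> at
  \<open>g v\<close> is \<open>det g\<close> times the form of \<open>X\<close> at
  \<open>v\<close>.\<close>

lemma pos_form_Ad:
  assumes "p \<in> aff_group" "pos_form X" shows "pos_form (Ad p X)"
proof -
  obtain g u where p: "p = (g, u)" "det g > 0" using assms(1) by (auto simp: aff_group_def)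
  then obtain h where h: "g ** h = mat 1"
    by (metis invertible_def invertible_det_nz less_irrefl)
  have eq: "wedge (g *v v) (fst (Ad p X) *v (g *v v)) = det g * wedge v (fst X *v v)" for v
    using assms(1) by (simp add: p(1) fst_Ad_mult matrix_vector_mul_assoc flip: wedge_mult)
  have "wedge v (fst (Ad p X) *v v) \<ge> 0" for v
  proof -
    have "g *v (h *v v) = v" by (simp add: matrix_vector_mul_assoc h)
    then show ?thesis
      using eq[of "h *v v"] assms(2) p(2) by (simp add: pos_form_def)
  qed
  moreover have "\<exists>v. wedge v (fst (Ad p X) *v v) > 0"
    using assms(2) p(2) eq unfolding pos_form_def by (metis mult_pos_pos)
  ultimately show ?thesis by (simp add: pos_form_def)
qed

definition translation_free :: "aff2 set \<Rightarrow> bool" where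
  "translation_free S \<longleftrightarrow> (\<forall>X\<in>S. fst X = 0 \<longrightarrow> X = 0)"

definition contains_translations :: "aff2 set \<Rightarrow> bool" where
  "contains_translations S \<longleftrightarrow> (\<forall>X. fst X = 0 \<longrightarrow> X \<in> S)"

definition has_dilation :: "aff2 set \<Rightarrow> bool" where
  "has_dilation S \<longleftrightarrow> (\<exists>X\<in>S. fst X = mat 1)"

text \<open>Here \<open>E = (1, - u)\<close> is the dilation about \<open>u\<close>, and \<open>bracket (A, v) E = (0, - A u - v)\<close>:
  the condition says that, up to the inner automorphism given by a translation, \<open>S\<close> is the sum of
  its linear part and its translations.\<close>

definition splits :: "aff2 set \<Rightarrow> bool" where
  "splits S \<longleftrightarrow> (\<exists>E. fst E = mat 1 \<and> (\<forall>X\<in>S. bracket X E \<in> S))"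

text \<open>A generator is determined only up to a factor; positivity restricts this factor to
  positive numbers and a nonzero discriminant then fixes it. For discriminant 0 only the sign of the
  trace is meaningful, which is what \<open>\<epsilon>\<close> records.\<close>

definition pos_inv :: "aff2 set \<Rightarrow> real \<Rightarrow> real \<Rightarrow> bool" where
  "pos_inv S t d \<longleftrightarrow> (\<exists>X\<in>S. pos_form X \<and> trace (fst X) = t \<and> disc X = d)"

text \<open>Discriminant 1 normalizes a hyperbolic generator up to sign, so the trace is recovered
  up to sign; the restriction to nonnegative \<open>\<kappa>\<close> removes this ambiguity.\<close>

definition hyperbolic_inv :: "aff2 set \<Rightarrow> real \<Rightarrow> bool" where
  "hyperbolic_inv S t \<longleftrightarrow> (\<exists>X\<in>S. disc X = 1 \<and> trace (fst X) = t)"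

text \<open>The eigenvalue on an invariant line tells the two coordinate axes apart, that is,
  \<open>S2_4\<close> from \<open>S2_5\<close>.\<close>

definition weight_inv :: "aff2 set \<Rightarrow> real \<Rightarrow> real \<Rightarrow> bool" where
  "weight_inv S t m \<longleftrightarrow> (\<exists>X\<in>S. \<exists>Y\<in>S. disc X = 1 \<and> trace (fst X) = t \<and>
    fst Y = 0 \<and> Y \<noteq> 0 \<and> bracket X Y = m *\<^sub>R Y)"

text \<open>If the linear part is the span of \<open>e\<^sub>2 + \<gamma> e\<^sub>4\<close> and \<open>e\<^sub>1\<close>, the condition
  forces \<open>X = e\<^sub>2 + \<gamma> e\<^sub>4 + t e\<^sub>1\<close> modulo translations, so that the trace of \<open>X\<close> recovers
  \<open>\<gamma>\<close>.\<close>

definition nonabelian_inv :: "aff2 set \<Rightarrow> real \<Rightarrow> bool" where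
  "nonabelian_inv S t \<longleftrightarrow> (\<exists>X\<in>S. \<exists>Y\<in>S. fst Y \<noteq> 0 \<and> fst (bracket X Y + Y) = 0 \<and> trace (fst X) = t)"

lemma fst_Ad_0_iff:
  assumes "p \<in> aff_group" shows "fst (Ad p X) = 0 \<longleftrightarrow> fst X = 0"
  using assms fst_Ad_scalar[of _ _ 0] Ad_inverse[OF assms]
  by (metis scaleR_zero_left)

lemma fst_Ad_1:
  assumes "p \<in> aff_group" "fst X = mat 1" shows "fst (Ad p X) = mat 1"
  using assms fst_Ad_scalar[of p X 1] by simp

text \<open>Implications suffice, because \<open>equivalent\<close> is symmetric;
  \<open>invariants\<close> turns them into equalities.\<close>

lemma invariants_Ad:
  fixes S :: "aff2 set"
  assumes p: "p \<in> aff_group"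
  defines "T \<equiv> Ad p ` S"
  shows "translation_free S \<Longrightarrow> translation_free T"
    and "contains_translations S \<Longrightarrow> contains_translations T"
    and "has_dilation S \<Longrightarrow> has_dilation T"
    and "splits S \<Longrightarrow> splits T"
    and "pos_inv S t d \<Longrightarrow> pos_inv T t d"
    and "hyperbolic_inv S t \<Longrightarrow> hyperbolic_inv T t"
    and "weight_inv S t d \<Longrightarrow> weight_inv T t d"
    and "nonabelian_inv S t \<Longrightarrow> nonabelian_inv T t"
proof -
  note inv_simps = p T_def Ad_0_iff fst_Ad_0_iff trace_Ad disc_Ad bracket_Ad
  show "translation_free S \<Longrightarrow> translation_free T"
    by (auto simp: translation_free_def inv_simps)
  show "contains_translations T" if "contains_translations S"
    unfolding contains_translations_def
  proof (intro allI impI)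
    fix X :: aff2 assume X: "fst X = 0"
    obtain Y where Y: "X = Ad p Y" using Ad_inverse[OF p] by metis
    with X have "fst Y = 0" by (simp add: inv_simps)
    with that have "Y \<in> S" unfolding contains_translations_def by blast
    with Y show "X \<in> T" by (simp add: T_def)
  qed
  show "has_dilation S \<Longrightarrow> has_dilation T"
    unfolding has_dilation_def T_def using fst_Ad_1[OF p] by blast
  show "splits T" if S: "splits S"
  proof -
    obtain E where E: "fst E = mat 1" "\<And>X. X \<in> S \<Longrightarrow> bracket X E \<in> S"
      using S unfolding splits_def by blast
    have "bracket (Ad p X) (Ad p E) \<in> T" if "X \<in> S" for X
      using E(2)[OF that] by (simp add: inv_simps)
    then show ?thesis
      unfolding splits_def T_def using fst_Ad_1[OF p E(1)] by blast
  qed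
  show "pos_inv S t d \<Longrightarrow> pos_inv T t d"
    using pos_form_Ad[OF p] by (force simp: pos_inv_def inv_simps)
  show "hyperbolic_inv S t \<Longrightarrow> hyperbolic_inv T t"
    by (auto simp: hyperbolic_inv_def inv_simps)
  show "weight_inv T t d" if S: "weight_inv S t d"
  proof -
    obtain X Y where XY: "X \<in> S" "Y \<in> S" "disc X = 1" "trace (fst X) = t" "fst Y = 0" "Y \<noteq> 0"
        "bracket X Y = d *\<^sub>R Y"
      using S unfolding weight_inv_def by blast
    have "bracket (Ad p X) (Ad p Y) = d *\<^sub>R Ad p Y"
      by (simp add: XY(7) p bracket_Ad linear_cmul[OF linear_Ad])
    with XY show ?thesis
      unfolding weight_inv_def T_def
      by (intro bexI[of _ "Ad p X"] bexI[of _ "Ad p Y"]) (simp_all add: inv_simps)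
  qed
  show "nonabelian_inv S t \<Longrightarrow> nonabelian_inv T t"
    by (fastforce simp: nonabelian_inv_def inv_simps simp del: fst_add simp flip: linear_add[OF linear_Ad])
qed

lemma invariants:
  assumes "equivalent S T"
  shows "translation_free S \<longleftrightarrow> translation_free T"
    and "contains_translations S \<longleftrightarrow> contains_translations T"
    and "has_dilation S \<longleftrightarrow> has_dilation T"
    and "splits S \<longleftrightarrow> splits T"
    and "pos_inv S t d \<longleftrightarrow> pos_inv T t d"
    and "hyperbolic_inv S t \<longleftrightarrow> hyperbolic_inv T t"
    and "weight_inv S t d \<longleftrightarrow> weight_inv T t d"
    and "nonabelian_inv S t \<longleftrightarrow> nonabelian_inv T t"
proof -
  obtain p q where "p \<in> aff_group" "T = Ad p ` S" "q \<in> aff_group" "S = Ad q ` T"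
    using assms equivalent_sym[OF assms] by (auto simp: equivalent_def Inn_def)
  then show "translation_free S \<longleftrightarrow> translation_free T"
    and "contains_translations S \<longleftrightarrow> contains_translations T"
    and "has_dilation S \<longleftrightarrow> has_dilation T"
    and "splits S \<longleftrightarrow> splits T"
    and "pos_inv S t d \<longleftrightarrow> pos_inv T t d"
    and "hyperbolic_inv S t \<longleftrightarrow> hyperbolic_inv T t"
    and "weight_inv S t d \<longleftrightarrow> weight_inv T t d"
    and "nonabelian_inv S t \<longleftrightarrow> nonabelian_inv T t"
    by (metis invariants_Ad)+
qed

lemma dim_equivalent:
  assumes "equivalent S T" shows "dim S = dim T"
proof -
  obtain p where p: "p \<in> aff_group" "T = Ad p ` S"
    using assms by (auto simp: equivalent_def Inn_def)
  have "inj (Ad p)" using Ad_inverse[OF p(1)] by (metis injI)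
  then show ?thesis
    unfolding p(2) by (metis dim_image_eq linear_Ad inj_on_subset subset_UNIV)
qed

lemma Bex_elt:
  "(\<exists>X\<in>S. P X) \<longleftrightarrow> (\<exists>x1 x2 x3 x4 y1 y2. elt x1 x2 x3 x4 y1 y2 \<in> S \<and> P (elt x1 x2 x3 x4 y1 y2))"
  by (metis elt_exhaust)

lemma Ball_elt:
  "(\<forall>X\<in>S. P X) \<longleftrightarrow> (\<forall>x1 x2 x3 x4 y1 y2. elt x1 x2 x3 x4 y1 y2 \<in> S \<longrightarrow> P (elt x1 x2 x3 x4 y1 y2))"
  by (metis elt_exhaust)

lemma fst_elt_eq_0 [simp]: "fst (elt x1 x2 x3 x4 y1 y2) = 0 \<longleftrightarrow> x1 = 0 \<and> x2 = 0 \<and> x3 = 0 \<and> x4 = 0"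
  by (auto simp: elt_def vec_eq_iff forall_2)

lemma fst_elt_eq_1 [simp]: "fst (elt x1 x2 x3 x4 y1 y2) = mat 1 \<longleftrightarrow> x1 = 0 \<and> x2 = 0 \<and> x3 = 0 \<and> x4 = 2"
  by (auto simp: elt_def vec_eq_iff forall_2 mat_def field_simps)

lemma trace_elt [simp]: "trace (fst (elt x1 x2 x3 x4 y1 y2)) = x4"
  by (simp add: elt_def trace_def sum_2 field_simps)

lemma disc_elt [simp]: "disc (elt x1 x2 x3 x4 y1 y2) = x2\<^sup>2 - 4 * x1 * x3"
  by (simp add: disc_def) (simp add: elt_def power2_eq_square field_simps)

lemma binary_form_nonneg_iff:
  fixes a b c :: real
  shows "(\<forall>x y. a * x\<^sup>2 - b * x * y + c * y\<^sup>2 \<ge> 0) \<longleftrightarrow> a \<ge> 0 \<and> c \<ge> 0 \<and> b\<^sup>2 \<le> 4 * a * c"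
proof (intro iffI conjI allI)
  assume *: "\<forall>x y. a * x\<^sup>2 - b * x * y + c * y\<^sup>2 \<ge> 0"
  from *[rule_format, of 1 0] show a: "a \<ge> 0" by simp
  from *[rule_format, of 0 1] show c: "c \<ge> 0" by simp
  show "b\<^sup>2 \<le> 4 * a * c"
  proof (cases "a = 0 \<and> c = 0")
    case True
    with *[rule_format, of 1 1] *[rule_format, of 1 "-1"] show ?thesis by simp
  next
    case False
    \<comment> \<open>The test vector \<open>(b, 2 a)\<close> is critical for the form in the first
      variable with the second fixed, and \<open>(2 c, b)\<close> is critical in the second; there
      the form takes the two values shown.\<close>
    have "0 \<le> a * (4 * a * c - b\<^sup>2)" "0 \<le> c * (4 * a * c - b\<^sup>2)"
      using *[rule_format, of b "2 * a"] *[rule_format, of "2 * c" b]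
      by (simp_all add: power2_eq_square algebra_simps)
    with False a c show ?thesis
      by (metis diff_ge_0_iff_ge linorder_not_less mult_neg_pos order_le_less zero_le_mult_iff)
  qed
next
  fix x y assume *: "a \<ge> 0 \<and> c \<ge> 0 \<and> b\<^sup>2 \<le> 4 * a * c"
  show "a * x\<^sup>2 - b * x * y + c * y\<^sup>2 \<ge> 0"
  proof (cases "a = 0")
    case True
    with * show ?thesis by simp
  next
    case False
    have "4 * a * (a * x\<^sup>2 - b * x * y + c * y\<^sup>2) = (2 * a * x - b * y)\<^sup>2 + (4 * a * c - b\<^sup>2) * y\<^sup>2"
      by (simp add: power2_eq_square algebra_simps)
    also have "\<dots> \<ge> 0" using * by simp
    finally show ?thesis using False * by (simp add: zero_le_mult_iff)
  qed
qed

lemma pos_form_elt [simp]: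
  "pos_form (elt x1 x2 x3 x4 y1 y2) \<longleftrightarrow> x1 \<ge> 0 \<and> x3 \<ge> 0 \<and> x2\<^sup>2 \<le> 4 * x1 * x3 \<and> (x1 \<noteq> 0 \<or> x3 \<noteq> 0)"
proof -
  have w: "wedge v (fst (elt x1 x2 x3 x4 y1 y2) *v v) = x1 * (v $ 1)\<^sup>2 - x2 * v $ 1 * v $ 2 + x3 * (v $ 2)\<^sup>2" for v
    by (simp add: wedge_def elt_def matrix_vector_mult_def sum_2 power2_eq_square field_simps)
  have ex: "(\<exists>v. wedge v (fst (elt x1 x2 x3 x4 y1 y2) *v v) > 0) \<longleftrightarrow>
      (\<exists>x y. x1 * x\<^sup>2 - x2 * x * y + x3 * y\<^sup>2 > 0)"
    unfolding w by (metis vector_2)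
  have all: "(\<forall>v. wedge v (fst (elt x1 x2 x3 x4 y1 y2) *v v) \<ge> 0) \<longleftrightarrow>
      (\<forall>x y. x1 * x\<^sup>2 - x2 * x * y + x3 * y\<^sup>2 \<ge> 0)"
    unfolding w by (metis vector_2)
  have "(\<exists>x y. x1 * x\<^sup>2 - x2 * x * y + x3 * y\<^sup>2 > 0) \<longleftrightarrow> x1 \<noteq> 0 \<or> x3 \<noteq> 0"
    if "x1 \<ge> 0 \<and> x3 \<ge> 0 \<and> x2\<^sup>2 \<le> 4 * x1 * x3"
  proof
    assume "\<exists>x y. x1 * x\<^sup>2 - x2 * x * y + x3 * y\<^sup>2 > 0"
    then show "x1 \<noteq> 0 \<or> x3 \<noteq> 0" using that by auto
  next
    assume "x1 \<noteq> 0 \<or> x3 \<noteq> 0"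
    then have "x1 * 1\<^sup>2 - x2 * 1 * 0 + x3 * 0\<^sup>2 > 0 \<or> x1 * 0\<^sup>2 - x2 * 0 * 1 + x3 * 1\<^sup>2 > 0"
      using that by auto
    then show "\<exists>x y. x1 * x\<^sup>2 - x2 * x * y + x3 * y\<^sup>2 > 0" by blast
  qed
  then show ?thesis
    unfolding pos_form_def ex all binary_form_nonneg_iff by blast
qed

section \<open>Inequivalence of the listed subalgebras\<close>

text \<open>Collects invariants that depend on the family but not on its parameter. They sort the
  list into twenty classes, so that the finer invariants are needed only inside a class.\<close>

definition shape :: "aff2 set \<Rightarrow> nat \<times> bool \<times> bool \<times> bool" where
  "shape S = (dim S, translation_free S, contains_translations S, has_dilation S)"

lemma translation_free_elt:
  "translation_free S \<longleftrightarrow> (\<forall>y1 y2. elt 0 0 0 0 y1 y2 \<in> S \<longrightarrow> y1 = 0 \<and> y2 = 0)"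
  unfolding translation_free_def Ball_elt by auto

lemma contains_translations_elt:
  "contains_translations S \<longleftrightarrow> (\<forall>y1 y2. elt 0 0 0 0 y1 y2 \<in> S)"
proof -
  have "contains_translations S \<longleftrightarrow> (\<forall>X\<in>UNIV. fst X = 0 \<longrightarrow> X \<in> S)"
    unfolding contains_translations_def by blast
  then show ?thesis
    unfolding Ball_elt by auto
qed

lemma has_dilation_elt:
  "has_dilation S \<longleftrightarrow> (\<exists>y1 y2. elt 0 0 0 2 y1 y2 \<in> S)"
  unfolding has_dilation_def Bex_elt by auto

lemma not_all_zero: "\<not> (\<forall>x::real. x = 0)"
  by (metis zero_neq_one)

lemma shape_subalg [simp]:
  "shape (subalg S1_1) = (1, False, False, False)"
  "shape (subalg (S1_2 a)) = (1, True, False, False)"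
  "shape (subalg S1_3) = (1, True, False, True)"
  "shape (subalg (S1_4 a)) = (1, True, False, False)"
  "shape (subalg S1_5) = (1, True, False, False)"
  "shape (subalg (S1_6 a)) = (1, True, False, False)"
  "shape (subalg (S1_7 a)) = (1, True, False, False)"
  "shape (subalg S2_1) = (2, False, True, False)"
  "shape (subalg (S2_2 a)) = (2, False, False, False)"
  "shape (subalg S2_3) = (2, False, False, True)"
  "shape (subalg (S2_4 a)) = (2, False, False, False)"
  "shape (subalg (S2_5 a)) = (2, False, False, False)"
  "shape (subalg S2_6) = (2, False, False, False)"
  "shape (subalg (S2_7 a)) = (2, False, False, False)"
  "shape (subalg S2_8) = (2, True, False, True)"
  "shape (subalg S2_9) = (2, True, False, True)"
  "shape (subalg S2_10) = (2, True, False, True)"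
  "shape (subalg (S2_11 a)) = (2, True, False, False)"
  "shape (subalg S2_12) = (2, True, False, False)"
  "shape (subalg S2_13) = (2, True, False, False)"
  "shape (subalg S3_1) = (3, False, True, False)"
  "shape (subalg S3_2) = (3, False, True, True)"
  "shape (subalg (S3_3 a)) = (3, False, True, False)"
  "shape (subalg (S3_4 a)) = (3, False, True, False)"
  "shape (subalg (S3_5 a)) = (3, False, True, False)"
  "shape (subalg S3_6) = (3, False, False, True)"
  "shape (subalg S3_7) = (3, False, False, True)"
  "shape (subalg (S3_8 a)) = (3, False, False, False)"
  "shape (subalg S3_9) = (3, False, False, False)"
  "shape (subalg S3_10) = (3, False, False, False)"
  "shape (subalg S3_11) = (3, True, False, True)"
  "shape (subalg S3_12) = (3, True, False, False)"
  "shape (subalg S4_1) = (4, False, True, True)"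
  "shape (subalg S4_2) = (4, False, True, True)"
  "shape (subalg S4_3) = (4, False, True, True)"
  "shape (subalg (S4_4 a)) = (4, False, True, False)"
  "shape (subalg S4_5) = (4, False, False, True)"
  "shape (subalg S4_6) = (4, True, False, True)"
  "shape (subalg S5_1) = (5, False, True, True)"
  "shape (subalg S5_2) = (5, False, True, False)"
  by (simp_all add: shape_def translation_free_elt contains_translations_elt has_dilation_elt not_all_zero
      subalg.simps elt_basis dim_insert span_breakdown_eq)

lemma pos_inv_elt:
  "pos_inv S t d \<longleftrightarrow> (\<exists>x1 x2 x3 y1 y2. elt x1 x2 x3 t y1 y2 \<in> S \<and> x1 \<ge> 0 \<and> x3 \<ge> 0 \<and>
    x2\<^sup>2 \<le> 4 * x1 * x3 \<and> (x1 \<noteq> 0 \<or> x3 \<noteq> 0) \<and> x2\<^sup>2 - 4 * x1 * x3 = d)"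
  unfolding pos_inv_def Bex_elt by auto

lemma pos_inv_nilpotent:
  "pos_inv (subalg (S1_2 a)) t d \<longleftrightarrow> t = 0 \<and> d = 0"
  "pos_inv (subalg (S1_6 a)) t d \<longleftrightarrow> d = 0 \<and> (\<exists>x>0. t = a * x)"
  "pos_inv (subalg (S2_2 a)) t d \<longleftrightarrow> t = 0 \<and> d = 0"
  "pos_inv (subalg (S2_7 a)) t d \<longleftrightarrow> d = 0 \<and> (\<exists>x>0. t = a * x)"
  "pos_inv (subalg S2_8) t d \<longleftrightarrow> d = 0"
  "pos_inv (subalg S3_1) t d \<longleftrightarrow> t = 0 \<and> d = 0"
  "pos_inv (subalg (S3_4 a)) t d \<longleftrightarrow> d = 0 \<and> (\<exists>x>0. t = a * x)"
  "pos_inv (subalg S3_6) t d \<longleftrightarrow> d = 0"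
  "pos_inv (subalg S4_1) t d \<longleftrightarrow> d = 0"
  by (auto simp: pos_inv_elt less_le intro: exI[of _ 1])

text \<open>With \<open>x1 = x3 = 0\<close> the form is \<open>- x2 v1 v2\<close>, which is either
  zero or indefinite.\<close>

lemma not_pos_inv_hyperbolic:
  "\<not> pos_inv (subalg (S1_4 a)) t d"
  "\<not> pos_inv (subalg S1_5) t d"
  "\<not> pos_inv (subalg (S2_4 a)) t d"
  "\<not> pos_inv (subalg (S2_5 a)) t d"
  "\<not> pos_inv (subalg S2_6) t d"
  "\<not> pos_inv (subalg S2_9) t d"
  "\<not> pos_inv (subalg (S3_3 a)) t d"
  "\<not> pos_inv (subalg S3_7) t d"
  "\<not> pos_inv (subalg S4_2) t d"
  by (auto simp: pos_inv_elt)

lemma pos_inv_elliptic: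
  "pos_inv (subalg (S1_7 a)) t d \<longleftrightarrow> (\<exists>x>0. t = a * x \<and> d = - 4 * x\<^sup>2)"
  "pos_inv (subalg S2_10) t d \<longleftrightarrow> (\<exists>x>0. d = - 4 * x\<^sup>2)"
  "pos_inv (subalg (S3_5 a)) t d \<longleftrightarrow> (\<exists>x>0. t = a * x \<and> d = - 4 * x\<^sup>2)"
  "pos_inv (subalg S4_3) t d \<longleftrightarrow> (\<exists>x>0. d = - 4 * x\<^sup>2)"
  by (auto simp: pos_inv_elt less_le power2_eq_square)

lemma hyperbolic_inv_elt:
  "hyperbolic_inv S t \<longleftrightarrow> (\<exists>x1 x2 x3 y1 y2. elt x1 x2 x3 t y1 y2 \<in> S \<and> x2\<^sup>2 - 4 * x1 * x3 = 1)"
  unfolding hyperbolic_inv_def Bex_elt by auto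

lemma hyperbolic_inv_subalg:
  "hyperbolic_inv (subalg (S1_4 a)) t \<longleftrightarrow> t = a \<or> t = - a"
  "hyperbolic_inv (subalg S1_5) t \<longleftrightarrow> t = 1 \<or> t = - 1"
  "hyperbolic_inv (subalg (S3_3 a)) t \<longleftrightarrow> t = a \<or> t = - a"
  by (auto simp: hyperbolic_inv_elt power2_eq_1_iff conj_disj_distribL ex_disj_distrib)

lemma weight_invI:
  assumes "elt 0 x 0 t y1 y2 \<in> S" "elt 0 0 0 0 z1 z2 \<in> S" "x\<^sup>2 = 1" "z1 \<noteq> 0 \<or> z2 \<noteq> 0"
    "(t + x) / 2 * z1 = m * z1" "(t - x) / 2 * z2 = m * z2"
  shows "weight_inv S t m"
  unfolding weight_inv_def using assms by (intro bexI[OF _ assms(1)] bexI[OF _ assms(2)]) auto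

text \<open>Modulo translations, the elements of discriminant 1 are the generator and its negative,
  so exactly two pairs \<open>(t, m)\<close> occur and they are opposite. The values of
  \<open>m\<close> are the eigenvalues of \<open>e\<^sub>2 + a e\<^sub>4\<close> on
  \<open>f\<^sub>1\<close> and on \<open>f\<^sub>2\<close>.\<close>

lemma weight_inv_subalg:
  "weight_inv (subalg (S2_4 a)) t m \<longleftrightarrow> (t = a \<and> m = (a + 1) / 2 \<or> t = - a \<and> m = - (a + 1) / 2)"
  "weight_inv (subalg (S2_5 a)) t m \<longleftrightarrow> (t = a \<and> m = (a - 1) / 2 \<or> t = - a \<and> m = - (a - 1) / 2)"
  "weight_inv (subalg S2_6) t m \<longleftrightarrow> (t = 1 \<and> m = 1 \<or> t = - 1 \<and> m = - 1)"
proof -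
  have "weight_inv (subalg (S2_4 a)) a ((a + 1) / 2)"
    by (rule weight_invI[of 1 _ 0 0 _ 1 0]) simp_all
  moreover have "weight_inv (subalg (S2_4 a)) (- a) (- (a + 1) / 2)"
    by (rule weight_invI[of "- 1" _ 0 0 _ 1 0]) simp_all
  moreover have "t = a \<and> m = (a + 1) / 2 \<or> t = - a \<and> m = - (a + 1) / 2"
    if "weight_inv (subalg (S2_4 a)) t m"
    using that by (auto simp: weight_inv_def Bex_elt power2_eq_1_iff)
  ultimately show "weight_inv (subalg (S2_4 a)) t m \<longleftrightarrow>
      (t = a \<and> m = (a + 1) / 2 \<or> t = - a \<and> m = - (a + 1) / 2)"
    by metis
next
  have "weight_inv (subalg (S2_5 a)) a ((a - 1) / 2)"
    by (rule weight_invI[of 1 _ 0 0 _ 0 1]) simp_all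
  moreover have "weight_inv (subalg (S2_5 a)) (- a) (- (a - 1) / 2)"
    by (rule weight_invI[of "- 1" _ 0 0 _ 0 1]) simp_all
  moreover have "t = a \<and> m = (a - 1) / 2 \<or> t = - a \<and> m = - (a - 1) / 2"
    if "weight_inv (subalg (S2_5 a)) t m"
    using that by (auto simp: weight_inv_def Bex_elt power2_eq_1_iff)
  ultimately show "weight_inv (subalg (S2_5 a)) t m \<longleftrightarrow>
      (t = a \<and> m = (a - 1) / 2 \<or> t = - a \<and> m = - (a - 1) / 2)"
    by metis
next
  have "weight_inv (subalg S2_6) 1 1"
    by (rule weight_invI[of 1 _ 0 1 _ 1 0]) simp_all
  moreover have "weight_inv (subalg S2_6) (- 1) (- 1)"
    by (rule weight_invI[of "- 1" _ 0 "- 1" _ 1 0]) simp_all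
  moreover have "t = 1 \<and> m = 1 \<or> t = - 1 \<and> m = - 1"
    if "weight_inv (subalg S2_6) t m"
    using that by (auto simp: weight_inv_def Bex_elt power2_eq_1_iff)
  ultimately show "weight_inv (subalg S2_6) t m \<longleftrightarrow> (t = 1 \<and> m = 1 \<or> t = - 1 \<and> m = - 1)"
    by metis
qed

lemma nonabelian_inv_subalg:
  "nonabelian_inv (subalg (S2_11 a)) t \<longleftrightarrow> t = a"
  "nonabelian_inv (subalg S2_12) t \<longleftrightarrow> t = 1"
  "nonabelian_inv (subalg S2_13) t \<longleftrightarrow> t = - 3"
  "nonabelian_inv (subalg (S3_8 a)) t \<longleftrightarrow> t = a"
  "nonabelian_inv (subalg S3_9) t \<longleftrightarrow> t = - 1"
  "nonabelian_inv (subalg S3_10) t \<longleftrightarrow> t = - 3"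
  "nonabelian_inv (subalg (S4_4 a)) t \<longleftrightarrow> t = a"
  by (auto simp: nonabelian_inv_def Bex_elt simp del: fst_add, ((rule exI[of _ 1])+, simp)+)

text \<open>The pair \<open>(w1, w2)\<close> is the translational part of the dilation
  \<open>E\<close>. The new element is the coboundary of \<open>w\<close> at \<open>X\<close> minus
  the translational part of \<open>X\<close>, so the lifts have to form a coboundary modulo
  translations.\<close>

lemma splits_elt:
  "splits S \<longleftrightarrow> (\<exists>w1 w2. \<forall>x1 x2 x3 x4 y1 y2. elt x1 x2 x3 x4 y1 y2 \<in> S \<longrightarrow>
    elt 0 0 0 0 ((x4 + x2) / 2 * w1 - x3 * w2 - y1) (x1 * w1 + (x4 - x2) / 2 * w2 - y2) \<in> S)"
proof -
  have "splits S \<longleftrightarrow> (\<exists>E\<in>UNIV. fst E = mat 1 \<and> (\<forall>X\<in>S. bracket X E \<in> S))"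
    unfolding splits_def by blast
  then show ?thesis
    unfolding Bex_elt Ball_elt by simp
qed

text \<open>A coboundary at \<open>e\<^sub>1\<close> is a multiple of \<open>f\<^sub>2\<close>, at
  \<open>e\<^sub>2 + e\<^sub>4\<close> a multiple of \<open>f\<^sub>1\<close>, and at
  \<open>e\<^sub>2 - e\<^sub>4\<close> a multiple of \<open>f\<^sub>2\<close>; the extra
  translations in the nonsplit entries point in the other direction.\<close>

lemma splits_subalg:
  "splits (subalg (S1_2 a)) \<longleftrightarrow> a = 0"
  "splits (subalg (S1_4 a))"
  "\<not> splits (subalg S1_5)"
  "splits (subalg (S2_2 a)) \<longleftrightarrow> a = 0"
  "splits (subalg (S2_4 a))"
  "splits (subalg (S2_5 a))"
  "\<not> splits (subalg S2_6)"
  "splits (subalg (S2_11 a))"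
  "splits (subalg (S3_8 a))"
  "\<not> splits (subalg S3_9)"
  by (auto simp: splits_elt not_all_zero intro: exI[of _ 0] exI[of _ 1])

text \<open>One generator already gives the contradiction:
  \<open>e\<^sub>2 + e\<^sub>4 + f\<^sub>2\<close> in the first case, where
  \<open>e\<^sub>2 + e\<^sub>4\<close> kills \<open>f\<^sub>2\<close>, and
  \<open>e\<^sub>1 + f\<^sub>1\<close> in the other two.\<close>

lemma not_splits_subalg:
  "\<not> splits (subalg S2_12)"
  "\<not> splits (subalg S2_13)"
  "\<not> splits (subalg S3_10)"
proof -
  have *: "\<exists>w1 w2. elt 0 0 0 0 ((x4 + x2) / 2 * w1 - x3 * w2 - y1) (x1 * w1 + (x4 - x2) / 2 * w2 - y2) \<in> S"
    if "splits S" "elt x1 x2 x3 x4 y1 y2 \<in> S" for x1 x2 x3 x4 y1 y2 S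
    using that unfolding splits_elt by blast
  show "\<not> splits (subalg S2_12)" using *[of "subalg S2_12" 0 1 0 1 0 1] by auto
  show "\<not> splits (subalg S2_13)" using *[of "subalg S2_13" 1 0 0 0 1 0] by auto
  show "\<not> splits (subalg S3_10)" using *[of "subalg S3_10" 1 0 0 0 1 0] by auto
qed

lemma shape_subalgD:
  "shape (subalg l) = (1, False, False, False) \<Longrightarrow> l \<in> {S1_1}"
  "shape (subalg l) = (1, True, False, False) \<Longrightarrow> l \<in> {S1_5} \<union> range S1_2 \<union> range S1_4 \<union> range S1_6 \<union> range S1_7"
  "shape (subalg l) = (1, True, False, True) \<Longrightarrow> l \<in> {S1_3}"
  "shape (subalg l) = (2, False, True, False) \<Longrightarrow> l \<in> {S2_1}"
  "shape (subalg l) = (2, False, False, False) \<Longrightarrow> l \<in> {S2_6} \<union> range S2_2 \<union> range S2_4 \<union> range S2_5 \<union> range S2_7"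
  "shape (subalg l) = (2, False, False, True) \<Longrightarrow> l \<in> {S2_3}"
  "shape (subalg l) = (2, True, False, True) \<Longrightarrow> l \<in> {S2_8, S2_9, S2_10}"
  "shape (subalg l) = (2, True, False, False) \<Longrightarrow> l \<in> {S2_12, S2_13} \<union> range S2_11"
  "shape (subalg l) = (3, False, True, False) \<Longrightarrow> l \<in> {S3_1} \<union> range S3_3 \<union> range S3_4 \<union> range S3_5"
  "shape (subalg l) = (3, False, True, True) \<Longrightarrow> l \<in> {S3_2}"
  "shape (subalg l) = (3, False, False, True) \<Longrightarrow> l \<in> {S3_6, S3_7}"
  "shape (subalg l) = (3, False, False, False) \<Longrightarrow> l \<in> {S3_9, S3_10} \<union> range S3_8"
  "shape (subalg l) = (3, True, False, True) \<Longrightarrow> l \<in> {S3_11}"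
  "shape (subalg l) = (3, True, False, False) \<Longrightarrow> l \<in> {S3_12}"
  "shape (subalg l) = (4, False, True, True) \<Longrightarrow> l \<in> {S4_1, S4_2, S4_3}"
  "shape (subalg l) = (4, False, True, False) \<Longrightarrow> l \<in> range S4_4"
  "shape (subalg l) = (4, False, False, True) \<Longrightarrow> l \<in> {S4_5}"
  "shape (subalg l) = (4, True, False, True) \<Longrightarrow> l \<in> {S4_6}"
  "shape (subalg l) = (5, False, True, True) \<Longrightarrow> l \<in> {S5_1}"
  "shape (subalg l) = (5, False, True, False) \<Longrightarrow> l \<in> {S5_2}"
  by (cases l; simp)+

lemma parameters_labels:
  "S1_2 a \<in> labels \<longleftrightarrow> a = 0 \<or> a = 1"
  "S1_4 a \<in> labels \<longleftrightarrow> a \<ge> 0"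
  "S1_6 a \<in> labels \<longleftrightarrow> a = - 1 \<or> a = 1"
  "S2_2 a \<in> labels \<longleftrightarrow> a = 0 \<or> a = 1"
  "S2_4 a \<in> labels \<longleftrightarrow> a \<ge> 0"
  "S2_5 a \<in> labels \<longleftrightarrow> a > 0"
  "S2_7 a \<in> labels \<longleftrightarrow> a = - 1 \<or> a = 1"
  "S3_3 a \<in> labels \<longleftrightarrow> a \<ge> 0"
  "S3_4 a \<in> labels \<longleftrightarrow> a = - 1 \<or> a = 1"
  by (auto simp: labels_def labels_1D_def labels_2D_def labels_3D_def labels_4D_def labels_5D_def)

text \<open>On a multiple \<open>x\<close> of \<open>e\<^sub>1 + e\<^sub>3\<close> the form is
  \<open>x (v1^2 + v2^2)\<close>. Positivity and discriminant \<open>- 4\<close> therefore force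
  \<open>x = 1\<close>, and the trace is then \<open>\<gamma>\<close> itself, including its
  sign.\<close>

lemma pos_inv_elliptic_values:
  "\<not> pos_inv (subalg (S1_7 a)) t 0"
  "\<not> pos_inv (subalg S2_10) t 0"
  "\<not> pos_inv (subalg (S3_5 a)) t 0"
  "\<not> pos_inv (subalg S4_3) t 0"
  "pos_inv (subalg (S1_7 a)) t (- 4) \<longleftrightarrow> t = a"
  "pos_inv (subalg S2_10) 0 (- 4)"
  "pos_inv (subalg (S3_5 a)) t (- 4) \<longleftrightarrow> t = a"
  "pos_inv (subalg S4_3) 0 (- 4)"
proof -
  have *: "x = 1" if "x > 0" "- 4 = - 4 * x\<^sup>2" for x :: real
    using that by (simp add: power2_eq_1_iff)
  show "pos_inv (subalg (S1_7 a)) t (- 4) \<longleftrightarrow> t = a" "pos_inv (subalg (S3_5 a)) t (- 4) \<longleftrightarrow> t = a"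
    unfolding pos_inv_elliptic by (auto dest: * intro: exI[of _ 1])
qed (auto simp: pos_inv_elliptic intro: exI[of _ 1])

lemma pos_inv_nilpotent_values:
  "pos_inv (subalg (S1_6 a)) 0 0 \<longleftrightarrow> a = 0" "pos_inv (subalg (S1_6 a)) 1 0 \<longleftrightarrow> a > 0"
    "pos_inv (subalg (S1_6 a)) (- 1) 0 \<longleftrightarrow> a < 0"
  "pos_inv (subalg (S2_7 a)) 0 0 \<longleftrightarrow> a = 0" "pos_inv (subalg (S2_7 a)) 1 0 \<longleftrightarrow> a > 0"
    "pos_inv (subalg (S2_7 a)) (- 1) 0 \<longleftrightarrow> a < 0"
  "pos_inv (subalg (S3_4 a)) 0 0 \<longleftrightarrow> a = 0" "pos_inv (subalg (S3_4 a)) 1 0 \<longleftrightarrow> a > 0"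
    "pos_inv (subalg (S3_4 a)) (- 1) 0 \<longleftrightarrow> a < 0"
  "\<not> pos_inv (subalg (S1_6 a)) t (- 4)" "\<not> pos_inv (subalg (S3_4 a)) t (- 4)"
proof -
  have "(\<exists>x>0. 0 = a * x) \<longleftrightarrow> a = 0" by (auto intro: exI[of _ 1])
  moreover have "(\<exists>x>0. - 1 = a * x) \<longleftrightarrow> a < 0"
    by (auto simp: mult_less_0_iff intro!: exI[of _ "- 1 / a"]) (metis mult_nonneg_nonneg neg_0_le_iff_le not_less not_one_le_zero order_less_imp_le)
  moreover have "(\<exists>x>0. 1 = a * x) \<longleftrightarrow> a > 0"
    by (auto simp: zero_less_mult_iff intro!: exI[of _ "1 / a"]) (metis zero_less_mult_pos2 zero_less_one)
  ultimately show
    "pos_inv (subalg (S1_6 a)) 0 0 \<longleftrightarrow> a = 0" "pos_inv (subalg (S1_6 a)) 1 0 \<longleftrightarrow> a > 0"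
    "pos_inv (subalg (S1_6 a)) (- 1) 0 \<longleftrightarrow> a < 0"
    "pos_inv (subalg (S2_7 a)) 0 0 \<longleftrightarrow> a = 0" "pos_inv (subalg (S2_7 a)) 1 0 \<longleftrightarrow> a > 0"
    "pos_inv (subalg (S2_7 a)) (- 1) 0 \<longleftrightarrow> a < 0"
    "pos_inv (subalg (S3_4 a)) 0 0 \<longleftrightarrow> a = 0" "pos_inv (subalg (S3_4 a)) 1 0 \<longleftrightarrow> a > 0"
    "pos_inv (subalg (S3_4 a)) (- 1) 0 \<longleftrightarrow> a < 0"
    by (simp_all only: pos_inv_nilpotent simp_thms)
qed (simp_all add: pos_inv_nilpotent)

lemma pm_eq_iff:
  fixes a b :: real
  shows "(\<forall>t. (t = a \<or> t = - a) = (t = b \<or> t = - b)) \<longleftrightarrow> a = b \<or> a = - b"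
    "(\<forall>t. (t = a \<or> t = - a) = (t = 1 \<or> t = - 1)) \<longleftrightarrow> a = 1 \<or> a = - 1"
    "(\<forall>t. (t = 1 \<or> t = - 1) = (t = a \<or> t = - a)) \<longleftrightarrow> a = 1 \<or> a = - 1"
  by (auto simp: minus_equation_iff)

lemma eq_iff_eq: "(\<forall>t. (t = a) = (t = b)) \<longleftrightarrow> a = b"
  by auto

text \<open>For parameter 0 both families would attain the values \<open>t = 0\<close>,
  \<open>m = 1/2\<close> and \<open>m = - 1/2\<close>, in accordance with the quarter turn that
  exchanges the axes. The comparison of the two families thus rests on \<open>b > 0\<close>.\<close>

lemma weight_inv_inj:
  "\<forall>t m. weight_inv (subalg (S2_4 a)) t m = weight_inv (subalg (S2_4 b)) t m \<Longrightarrow> a \<ge> 0 \<Longrightarrow> b \<ge> 0 \<Longrightarrow> a = b"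
  "\<forall>t m. weight_inv (subalg (S2_5 a)) t m = weight_inv (subalg (S2_5 b)) t m \<Longrightarrow> a > 0 \<Longrightarrow> b > 0 \<Longrightarrow> a = b"
  "\<forall>t m. weight_inv (subalg (S2_4 a)) t m = weight_inv (subalg (S2_5 b)) t m \<Longrightarrow> a \<ge> 0 \<Longrightarrow> b > 0 \<Longrightarrow> False"
  "\<forall>t m. weight_inv (subalg (S2_5 b)) t m = weight_inv (subalg (S2_4 a)) t m \<Longrightarrow> a \<ge> 0 \<Longrightarrow> b > 0 \<Longrightarrow> False"
  by (drule spec2[of _ a "(a + 1) / 2"], auto simp: weight_inv_subalg,
      drule spec2[of _ a "(a - 1) / 2"], auto simp: weight_inv_subalg,
      drule spec2[of _ a "(a + 1) / 2"], auto simp: weight_inv_subalg,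
      drule spec2[of _ b "(b - 1) / 2"], auto simp: weight_inv_subalg)

lemma labels_inequivalent:
  assumes "l \<in> labels" "l' \<in> labels" "equivalent (subalg l) (subalg l')"
  shows "l = l'"
proof -
  note inv = invariants[OF assms(3)]
  have eq: "shape (subalg l) = shape (subalg l')"
    using assms(3) by (simp add: shape_def dim_equivalent inv)
  have pos_all: "\<forall>t. pos_inv (subalg l) t (- 4) = pos_inv (subalg l') t (- 4)"
    and hyperbolic_all: "\<forall>t. hyperbolic_inv (subalg l) t = hyperbolic_inv (subalg l') t"
    and weight_all: "\<forall>t m. weight_inv (subalg l) t m = weight_inv (subalg l') t m"
    and nonabelian_all: "\<forall>t. nonabelian_inv (subalg l) t = nonabelian_inv (subalg l') t"
    by (simp_all only: inv simp_thms)
  note pos_inv_subalg = pos_inv_nilpotent(1,3,5,6,8,9) pos_inv_nilpotent_values not_pos_inv_hyperbolic pos_inv_elliptic_values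
  consider
      "shape (subalg l) = (1, False, False, False)"
    | "shape (subalg l) = (1, True, False, False)"
    | "shape (subalg l) = (1, True, False, True)"
    | "shape (subalg l) = (2, False, True, False)"
    | "shape (subalg l) = (2, False, False, False)"
    | "shape (subalg l) = (2, False, False, True)"
    | "shape (subalg l) = (2, True, False, True)"
    | "shape (subalg l) = (2, True, False, False)"
    | "shape (subalg l) = (3, False, True, False)"
    | "shape (subalg l) = (3, False, True, True)"
    | "shape (subalg l) = (3, False, False, True)"
    | "shape (subalg l) = (3, False, False, False)"
    | "shape (subalg l) = (3, True, False, True)"
    | "shape (subalg l) = (3, True, False, False)"
    | "shape (subalg l) = (4, False, True, True)"
    | "shape (subalg l) = (4, False, True, False)"
    | "shape (subalg l) = (4, False, False, True)"
    | "shape (subalg l) = (4, True, False, True)"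
    | "shape (subalg l) = (5, False, True, True)"
    | "shape (subalg l) = (5, False, True, False)"
    by (cases l) simp_all
  then show ?thesis
  proof cases
    case 1
    then show ?thesis
      using shape_subalgD(1)[of l] shape_subalgD(1)[of l'] eq by simp
  next
    case 2
    moreover from this eq have "shape (subalg l') = (1, True, False, False)" by simp
    ultimately have "l \<in> {S1_5} \<union> range S1_2 \<union> range S1_4 \<union> range S1_6 \<union> range S1_7" "l' \<in> {S1_5} \<union> range S1_2 \<union> range S1_4 \<union> range S1_6 \<union> range S1_7"
      by (simp_all only: shape_subalgD(2))
    \<comment> \<open>Splitting separates the two values of \<open>\<delta>\<close> and tells
      \<open>S1_5\<close> from \<open>S1_4 1\<close>, which attains the same traces. Discriminant 0
      detects the nilpotent families and \<open>\<epsilon>\<close>, discriminant \<open>- 4\<close>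
      recovers \<open>\<gamma>\<close>, and discriminant 1 recovers \<open>\<kappa>\<close>.\<close>
    then show ?thesis
      using assms(1,2) inv(4) inv(5)[of 0 0] inv(5)[of 1 0] inv(5)[of "- 1" 0] pos_all hyperbolic_all
      by (elim UnE insertE rangeE emptyE; hypsubst_thin)
        (auto simp: parameters_labels pos_inv_subalg hyperbolic_inv_subalg nonabelian_inv_subalg
          splits_subalg not_splits_subalg pm_eq_iff eq_iff_eq)
  next
    case 3
    then show ?thesis
      using shape_subalgD(3)[of l] shape_subalgD(3)[of l'] eq by simp
  next
    case 4
    then show ?thesis
      using shape_subalgD(4)[of l] shape_subalgD(4)[of l'] eq by simp
  next
    case 5
    moreover from this eq have "shape (subalg l') = (2, False, False, False)" by simp
    ultimately have "l \<in> {S2_6} \<union> range S2_2 \<union> range S2_4 \<union> range S2_5 \<union> range S2_7" "l' \<in> {S2_6} \<union> range S2_2 \<union> range S2_4 \<union> range S2_5 \<union> range S2_7"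
      by (simp_all only: shape_subalgD(5))
    \<comment> \<open>The hyperbolic families now need the eigenvalue on the line of translations
      besides the trace. \<open>S2_6\<close> has the same weights as \<open>S2_4 1\<close> and
      differs from it by splitting.\<close>
    then show ?thesis
      using assms(1,2) inv(4) inv(5)[of 0 0] inv(5)[of 1 0] inv(5)[of "- 1" 0] weight_all
      by (elim UnE insertE rangeE emptyE; hypsubst_thin)
        (auto simp: parameters_labels pos_inv_subalg hyperbolic_inv_subalg nonabelian_inv_subalg
          splits_subalg not_splits_subalg pm_eq_iff eq_iff_eq dest: weight_inv_inj)
  next
    case 6
    then show ?thesis
      using shape_subalgD(6)[of l] shape_subalgD(6)[of l'] eq by simp
  next
    case 7
    moreover from this eq have "shape (subalg l') = (2, True, False, True)" by simp
    ultimately have "l \<in> {S2_8, S2_9, S2_10}" "l' \<in> {S2_8, S2_9, S2_10}"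
      by (simp_all only: shape_subalgD(7))
    then show ?thesis
      using assms(1,2) inv(5)[of 0 0] inv(5)[of 0 "- 4"]
      by (elim UnE insertE rangeE emptyE; hypsubst_thin)
        (auto simp: parameters_labels pos_inv_subalg hyperbolic_inv_subalg nonabelian_inv_subalg
          splits_subalg not_splits_subalg pm_eq_iff eq_iff_eq)
  next
    case 8
    moreover from this eq have "shape (subalg l') = (2, True, False, False)" by simp
    ultimately have "l \<in> {S2_12, S2_13} \<union> range S2_11" "l' \<in> {S2_12, S2_13} \<union> range S2_11"
      by (simp_all only: shape_subalgD(8))
    \<comment> \<open>\<open>S2_12\<close> and \<open>S2_13\<close> attain the traces of
      \<open>S2_11 1\<close> and \<open>S2_11 (- 3)\<close>, but do not split.\<close>
    then show ?thesis
      using assms(1,2) inv(4) nonabelian_all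
      by (elim UnE insertE rangeE emptyE; hypsubst_thin)
        (auto simp: parameters_labels pos_inv_subalg hyperbolic_inv_subalg nonabelian_inv_subalg
          splits_subalg not_splits_subalg pm_eq_iff eq_iff_eq)
  next
    case 9
    moreover from this eq have "shape (subalg l') = (3, False, True, False)" by simp
    ultimately have "l \<in> {S3_1} \<union> range S3_3 \<union> range S3_4 \<union> range S3_5" "l' \<in> {S3_1} \<union> range S3_3 \<union> range S3_4 \<union> range S3_5"
      by (simp_all only: shape_subalgD(9))
    then show ?thesis
      using assms(1,2) inv(5)[of 0 0] inv(5)[of 1 0] inv(5)[of "- 1" 0] pos_all hyperbolic_all
      by (elim UnE insertE rangeE emptyE; hypsubst_thin)
        (auto simp: parameters_labels pos_inv_subalg hyperbolic_inv_subalg nonabelian_inv_subalg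
          splits_subalg not_splits_subalg pm_eq_iff eq_iff_eq)
  next
    case 10
    then show ?thesis
      using shape_subalgD(10)[of l] shape_subalgD(10)[of l'] eq by simp
  next
    case 11
    moreover from this eq have "shape (subalg l') = (3, False, False, True)" by simp
    ultimately have "l \<in> {S3_6, S3_7}" "l' \<in> {S3_6, S3_7}"
      by (simp_all only: shape_subalgD(11))
    then show ?thesis
      using assms(1,2) inv(5)[of 0 0]
      by (elim UnE insertE rangeE emptyE; hypsubst_thin)
        (auto simp: parameters_labels pos_inv_subalg hyperbolic_inv_subalg nonabelian_inv_subalg
          splits_subalg not_splits_subalg pm_eq_iff eq_iff_eq)
  next
    case 12
    moreover from this eq have "shape (subalg l') = (3, False, False, False)" by simp
    ultimately have "l \<in> {S3_9, S3_10} \<union> range S3_8" "l' \<in> {S3_9, S3_10} \<union> range S3_8"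
      by (simp_all only: shape_subalgD(12))
    then show ?thesis
      using assms(1,2) inv(4) nonabelian_all
      by (elim UnE insertE rangeE emptyE; hypsubst_thin)
        (auto simp: parameters_labels pos_inv_subalg hyperbolic_inv_subalg nonabelian_inv_subalg
          splits_subalg not_splits_subalg pm_eq_iff eq_iff_eq)
  next
    case 13
    then show ?thesis
      using shape_subalgD(13)[of l] shape_subalgD(13)[of l'] eq by simp
  next
    case 14
    then show ?thesis
      using shape_subalgD(14)[of l] shape_subalgD(14)[of l'] eq by simp
  next
    case 15
    moreover from this eq have "shape (subalg l') = (4, False, True, True)" by simp
    ultimately have "l \<in> {S4_1, S4_2, S4_3}" "l' \<in> {S4_1, S4_2, S4_3}"
      by (simp_all only: shape_subalgD(15))
    then show ?thesis
      using assms(1,2) inv(5)[of 0 0] inv(5)[of 0 "- 4"]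
      by (elim UnE insertE rangeE emptyE; hypsubst_thin)
        (auto simp: parameters_labels pos_inv_subalg hyperbolic_inv_subalg nonabelian_inv_subalg
          splits_subalg not_splits_subalg pm_eq_iff eq_iff_eq)
  next
    case 16
    moreover from this eq have "shape (subalg l') = (4, False, True, False)" by simp
    ultimately have "l \<in> range S4_4" "l' \<in> range S4_4"
      by (simp_all only: shape_subalgD(16))
    then show ?thesis
      using assms(1,2) nonabelian_all
      by (elim UnE insertE rangeE emptyE; hypsubst_thin)
        (auto simp: parameters_labels pos_inv_subalg hyperbolic_inv_subalg nonabelian_inv_subalg
          splits_subalg not_splits_subalg pm_eq_iff eq_iff_eq)
  next
    case 17
    then show ?thesis
      using shape_subalgD(17)[of l] shape_subalgD(17)[of l'] eq by simp
  next
    case 18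
    then show ?thesis
      using shape_subalgD(18)[of l] shape_subalgD(18)[of l'] eq by simp
  next
    case 19
    then show ?thesis
      using shape_subalgD(19)[of l] shape_subalgD(19)[of l'] eq by simp
  next
    case 20
    then show ?thesis
      using shape_subalgD(20)[of l] shape_subalgD(20)[of l'] eq by simp
  qed
qed

section \<open>Normal forms\<close>

definition classified :: "aff2 set \<Rightarrow> bool" where
  "classified S \<longleftrightarrow> (\<exists>l\<in>labels. equivalent S (subalg l))"

lemma classified_Ad:
  assumes "p \<in> aff_group" "classified (Ad p ` S)" shows "classified S"
  using assms equivalent_Ad equivalent_trans unfolding classified_def by blast

text \<open>As \<open>Ad p\<close> is surjective, it suffices to pull the equations of the normal
  form back along \<open>Ad p\<close>; neither an image nor an inverse has to be described.\<close>

lemma classifiedI: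
  assumes "p \<in> aff_group" "l \<in> labels"
    "\<And>x1 x2 x3 x4 y1 y2. elt x1 x2 x3 x4 y1 y2 \<in> S \<longleftrightarrow> Ad p (elt x1 x2 x3 x4 y1 y2) \<in> subalg l"
  shows "classified S"
proof -
  obtain q where q: "\<And>X. Ad p (Ad q X) = X"
    using Ad_inverse[OF assms(1)] by metis
  have "X \<in> S \<longleftrightarrow> Ad p X \<in> subalg l" for X
    by (cases X rule: elt_exhaust) (simp only: assms(3))
  then have "Ad p ` S = subalg l"
    using q by (metis (no_types, lifting) image_eqI image_subsetI subsetI subset_antisym)
  then show ?thesis
    using assms(1,2) unfolding classified_def equivalent_def Inn_def by blast
qed

lemma classified_subalg:
  assumes "l \<in> labels"
    "\<And>x1 x2 x3 x4 y1 y2. elt x1 x2 x3 x4 y1 y2 \<in> S \<longleftrightarrow> elt x1 x2 x3 x4 y1 y2 \<in> subalg l"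
  shows "classified S"
  using assms by (intro classifiedI[of "(mat 1, 0)"]) (simp_all add: Ad_id aff_group_def)

text \<open>The set \<open>Q\<close> of the overview. Scalar matrices are central, so forgetting
  \<open>x4\<close> and the translation is a homomorphism onto the trace-free matrices, and
  \<open>lin S\<close> is again closed under brackets.\<close>

definition lin :: "aff2 set \<Rightarrow> (real \<times> real \<times> real) set" where
  "lin S = {(x1, x2, x3). \<exists>x4 y1 y2. elt x1 x2 x3 x4 y1 y2 \<in> S}"

definition trans_part :: "aff2 set \<Rightarrow> (real \<times> real) set" where
  "trans_part S = {(y1, y2). elt 0 0 0 0 y1 y2 \<in> S}"

lemma linI: "elt x1 x2 x3 x4 y1 y2 \<in> S \<Longrightarrow> (x1, x2, x3) \<in> lin S"
  by (auto simp: lin_def)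

lemma trans_partD: "(y1, y2) \<in> trans_part S \<Longrightarrow> elt 0 0 0 0 y1 y2 \<in> S"
  by (simp add: trans_part_def)

lemma Ad_shift:
  "Ad (mat 1, vector [u1, u2]) (elt x1 x2 x3 x4 y1 y2) =
    elt x1 x2 x3 x4 (y1 - (x4 + x2) / 2 * u1 + x3 * u2) (y2 - x1 * u1 - (x4 - x2) / 2 * u2)"
proof -
  have "mat 1 = mat2 1 0 0 1" by (simp add: vec_eq_iff forall_2 mat_def)
  then show ?thesis using Ad_elt[of 1 1 0 0] by simp
qed

lemma Ad_diag:
  assumes "a * d \<noteq> 0"
  shows "Ad (mat2 a 0 0 d, vector [u1, u2]) (elt x1 x2 x3 x4 y1 y2) =
    elt (d / a * x1) x2 (a / d * x3) x4 (a * y1 - (x4 + x2) / 2 * u1 + a / d * x3 * u2)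
      (d * y2 - d / a * x1 * u1 - (x4 - x2) / 2 * u2)"
  using Ad_elt[of a d 0 0] assms by (simp add: power2_eq_square)

lemma Ad_rotate:
  "Ad (mat2 0 (- 1) 1 0, vector [u1, u2]) (elt x1 x2 x3 x4 y1 y2) =
    elt x3 (- x2) x1 x4 (- y2 - (x4 - x2) / 2 * u1 + x1 * u2) (y1 - x3 * u1 - (x4 + x2) / 2 * u2)"
  using Ad_elt[of 0 0 "- 1" 1] by simp

lemma shift_in_aff_group [simp]: "(mat 1, u) \<in> aff_group"
  by (simp add: aff_group_def)

lemma diag_in_aff_group [simp]: "(mat2 a 0 0 d, u) \<in> aff_group \<longleftrightarrow> a * d > 0"
  by (simp add: aff_group_def)

lemma rotate_in_aff_group [simp]: "(mat2 0 (- 1) 1 0, u) \<in> aff_group"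
  by (simp add: aff_group_def)

text \<open>The given matrix carries the normal form \<open>k\<close> to \<open>x\<close>, and
  \<open>p\<close> is the inverse map. In this direction the columns of the matrix can be chosen as
  vectors adapted to \<open>x\<close>, such as eigenvectors. Translational parts are left
  unspecified, since they are normalized later.\<close>

lemma Ad_inverse_elt:
  fixes a b c d x1 x2 x3 y1 y2 :: real
  defines "D \<equiv> a * d - b * c"
  assumes "D > 0" "D * x1 = d\<^sup>2 * k1 + c * d * k2 + c\<^sup>2 * k3"
    "D * x2 = 2 * b * d * k1 + (a * d + b * c) * k2 + 2 * a * c * k3"
    "D * x3 = b\<^sup>2 * k1 + a * b * k2 + a\<^sup>2 * k3"
  shows "\<exists>p z1 z2. p \<in> aff_group \<and> Ad p (elt x1 x2 x3 x4 y1 y2) = elt k1 k2 k3 x4 z1 z2"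
proof -
  let ?q = "(mat2 a b c d, vector [0, 0])"
  let ?Y = "elt k1 k2 k3 x4 ((d * y1 - b * y2) / D) ((a * y2 - c * y1) / D)"
  have x: "x1 = (d\<^sup>2 * k1 + c * d * k2 + c\<^sup>2 * k3) / D"
    "x2 = (2 * b * d * k1 + (a * d + b * c) * k2 + 2 * a * c * k3) / D"
    "x3 = (b\<^sup>2 * k1 + a * b * k2 + a\<^sup>2 * k3) / D"
    using assms(2-) by (simp_all add: eq_divide_eq mult.commute)
  have "a * ((d * y1 - b * y2) / D) + b * ((a * y2 - c * y1) / D) = (D * y1) / D"
    "c * ((d * y1 - b * y2) / D) + d * ((a * y2 - c * y1) / D) = (D * y2) / D"
    unfolding times_divide_eq_right add_divide_distrib[symmetric]
    by (simp_all add: D_def algebra_simps)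
  then have "Ad ?q ?Y = elt x1 x2 x3 x4 y1 y2"
    using assms(2) Ad_elt[of a d b c] unfolding x D_def by simp
  moreover have "?q \<in> aff_group" using assms(2) by (simp add: aff_group_def D_def)
  then obtain p where "p \<in> aff_group" "\<And>X. Ad p (Ad ?q X) = X"
    by (metis Ad_inverse)
  ultimately show ?thesis by metis
qed

text \<open>In terms of the quadratic form, two real root lines are moved to the axes, a double root
  line is moved to one axis, and a definite form becomes a multiple of the sum of squares. The
  factor \<open>k\<close> keeps its sign, as only positive determinants are available.\<close>

lemma normalize_linear_part:
  assumes "(x1, x2, x3) \<noteq> (0, 0, 0)"
  obtains p k k1 k2 k3 z1 z2 where "p \<in> aff_group" "k \<noteq> 0"
    "(k1, k2, k3) \<in> {(1, 0, 0), (0, 1, 0), (1, 0, 1)}"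
    "Ad p (elt x1 x2 x3 x4 y1 y2) = elt (k * k1) (k * k2) (k * k3) x4 z1 z2"
proof -
  define \<Delta> where "\<Delta> = x2\<^sup>2 - 4 * x1 * x3"
  consider "\<Delta> > 0" | "\<Delta> = 0" "x1 \<noteq> 0" | "\<Delta> = 0" "x1 = 0" | "\<Delta> < 0" by linarith
  then show ?thesis
  proof cases
    case 1
    \<comment> \<open>Half of \<open>k\<close> is an eigenvalue of the trace-free part. Giving
      \<open>k\<close> the sign of \<open>x2\<close> prevents cancellation in
      \<open>m = x2 + k\<close>, which is then nonzero with the sign of \<open>k\<close>.\<close>
    define k where "k = (if x2 \<ge> 0 then sqrt \<Delta> else - sqrt \<Delta>)"
    define m where "m = x2 + k"
    have k: "k\<^sup>2 = x2\<^sup>2 - 4 * x1 * x3" "k \<noteq> 0"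
      using 1 by (auto simp: k_def \<Delta>_def)
    have "sqrt \<Delta> > 0" using 1 by simp
    then have km: "k > 0 \<and> m > 0 \<or> k < 0 \<and> m < 0"
      unfolding k_def m_def by (cases "x2 \<ge> 0"; simp only: if_True if_False; linarith)
    \<comment> \<open>The columns \<open>(1, c)\<close> and \<open>(b, 1)\<close> are eigenvectors
      for \<open>k / 2\<close> and \<open>- k / 2\<close>. Their determinant is
      \<open>2 k / m\<close>, which is positive by the choice of the sign of
      \<open>k\<close>.\<close>
    define b c where "b = 2 * x3 / m" and "c = 2 * x1 / m"
    have "1 - b * c = (m\<^sup>2 - 4 * x1 * x3) / m\<^sup>2"
      using km by (auto simp: b_def c_def diff_divide_distrib power2_eq_square)
    also have "m\<^sup>2 - 4 * x1 * x3 = 2 * k * m"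
      using k(1) by (simp add: m_def power2_eq_square algebra_simps)
    finally have bc: "1 - b * c = 2 * k / m"
      by (simp add: power2_eq_square)
    then have "b * c = 1 - 2 * k / m" by linarith
    then have bc': "1 + b * c = 2 * x2 / m"
      using km by (auto simp: m_def field_simps)
    have "\<exists>p z1 z2. p \<in> aff_group \<and> Ad p (elt x1 x2 x3 x4 y1 y2) = elt 0 k 0 x4 z1 z2"
      using km by (intro Ad_inverse_elt[where a=1 and b=b and c=c and d=1])
        (auto simp: bc bc' zero_less_divide_iff, auto simp: b_def c_def)
    then show ?thesis using k(2) that[of _ k 0 1 0] by auto
  next
    case 2
    have "\<exists>p z1 z2. p \<in> aff_group \<and> Ad p (elt x1 x2 x3 x4 y1 y2) = elt x1 0 0 x4 z1 z2"
      \<comment> \<open>This shear completes the square in the quadratic form.\<close>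
      using 2 by (intro Ad_inverse_elt[where a=1 and b="x2 / (2 * x1)" and c=0 and d=1])
        (auto simp: \<Delta>_def power2_eq_square field_simps)
    then show ?thesis using 2 that[of _ x1 1 0 0] by auto
  next
    case 3
    have "\<exists>p z1 z2. p \<in> aff_group \<and> Ad p (elt x1 x2 x3 x4 y1 y2) = elt x3 0 0 x4 z1 z2"
      using 3 by (intro Ad_inverse_elt[where a=0 and b=1 and c="-1" and d=0])
        (auto simp: \<Delta>_def)
    then show ?thesis using 3 assms that[of _ x3 1 0 0] by (auto simp: \<Delta>_def)
  next
    case 4
    \<comment> \<open>The determinant of the matrix used below is \<open>x1 / k\<close>, so
      \<open>k\<close> must have the sign of \<open>x1\<close>.\<close>
    define k where "k = (if x1 > 0 then sqrt (- \<Delta>) / 2 else - sqrt (- \<Delta>) / 2)"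
    have "x1 \<noteq> 0" using 4 by (auto simp: \<Delta>_def)
    then have k: "4 * k\<^sup>2 = 4 * x1 * x3 - x2\<^sup>2" "k \<noteq> 0" "x1 / k > 0"
      using 4 by (auto simp: k_def \<Delta>_def power_divide zero_less_divide_iff)
    have "\<exists>p z1 z2. p \<in> aff_group \<and> Ad p (elt x1 x2 x3 x4 y1 y2) = elt k 0 k x4 z1 z2"
      using k by (intro Ad_inverse_elt[where a=1 and b="x2 / (2 * k)" and c=0 and d="x1 / k"])
        (auto simp: power2_eq_square field_simps)
    then show ?thesis using k(2) that[of _ k 1 0 1] by auto
  qed
qed

section \<open>Normal form of the linear part of a subalgebra\<close>

lemma subalgebra_add: "subalgebra S \<Longrightarrow> X \<in> S \<Longrightarrow> Y \<in> S \<Longrightarrow> X + Y \<in> S"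
  and subalgebra_diff: "subalgebra S \<Longrightarrow> X \<in> S \<Longrightarrow> Y \<in> S \<Longrightarrow> X - Y \<in> S"
  and subalgebra_scale: "subalgebra S \<Longrightarrow> X \<in> S \<Longrightarrow> k *\<^sub>R X \<in> S"
  and subalgebra_bracket: "subalgebra S \<Longrightarrow> X \<in> S \<Longrightarrow> Y \<in> S \<Longrightarrow> bracket X Y \<in> S"
  by (simp_all add: subalgebra_def subspace_add subspace_diff subspace_scale)

lemma linE:
  assumes "(x1, x2, x3) \<in> lin S" obtains x4 y1 y2 where "elt x1 x2 x3 x4 y1 y2 \<in> S"
  using assms by (auto simp: lin_def)

lemma lin_closed:
  assumes "subalgebra S" "(x1, x2, x3) \<in> lin S" "(z1, z2, z3) \<in> lin S"
  shows "(x1 + z1, x2 + z2, x3 + z3) \<in> lin S"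
    and "(x1 - z1, x2 - z2, x3 - z3) \<in> lin S"
    and "(k * x1, k * x2, k * x3) \<in> lin S"
    and "(x1 * z2 - x2 * z1, 2 * (x1 * z3 - x3 * z1), x2 * z3 - x3 * z2) \<in> lin S"
proof -
  obtain x4 y1 y2 z4 w1 w2 where *: "elt x1 x2 x3 x4 y1 y2 \<in> S" "elt z1 z2 z3 z4 w1 w2 \<in> S"
    using assms(2,3) by (auto simp: lin_def)
  show "(x1 + z1, x2 + z2, x3 + z3) \<in> lin S"
    using subalgebra_add[OF assms(1) *] by (auto intro: linI)
  show "(x1 - z1, x2 - z2, x3 - z3) \<in> lin S"
    using subalgebra_diff[OF assms(1) *] by (auto intro: linI)
  show "(k * x1, k * x2, k * x3) \<in> lin S"
    using subalgebra_scale[OF assms(1) *(1)] by (auto intro: linI)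
  show "(x1 * z2 - x2 * z1, 2 * (x1 * z3 - x3 * z1), x2 * z3 - x3 * z2) \<in> lin S"
    using subalgebra_bracket[OF assms(1) *] by (auto intro: linI)
qed

lemma lin_0: "subalgebra S \<Longrightarrow> (0, 0, 0) \<in> lin S"
  by (rule linI[of _ _ _ 0 0 0]) (simp add: subalgebra_def subspace_0 flip: elt_0)

text \<open>The determinant of two vectors and their bracket is, up to a constant factor, the
  discriminant of the bracket.\<close>

lemma lin_eq_UNIV:
  assumes S: "subalgebra S" and a: "(a1, a2, a3) \<in> lin S" and b: "(b1, b2, b3) \<in> lin S"
    and n: "n1 = a1 * b2 - a2 * b1" "n2 = 2 * (a1 * b3 - a3 * b1)" "n3 = a2 * b3 - a3 * b2"
    and nz: "n2\<^sup>2 \<noteq> 4 * n1 * n3"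
  shows "lin S = UNIV"
proof -
  have n': "(n1, n2, n3) \<in> lin S"
    unfolding n by (rule lin_closed(4)[OF S a b])
  define D where "D = 4 * n1 * n3 - n2\<^sup>2"
  have D: "D \<noteq> 0" using nz by (simp add: D_def)
  have "(z1, z2, z3) \<in> lin S" for z1 z2 z3
  proof -
    \<comment> \<open>Cramer's rule for \<open>z = r a + s b + t n\<close>, whose determinant is
      \<open>D / 2\<close>. The formula for \<open>t\<close> is the orthogonal projection onto
      \<open>n\<close> for the trace form, since \<open>n\<close> is orthogonal to \<open>a\<close>
      and \<open>b\<close>.\<close>
    define r s t where
      "r = 2 * (z1 * (b2 * n3 - b3 * n2) + z2 * (b3 * n1 - b1 * n3) + z3 * (b1 * n2 - b2 * n1)) / D" and
      "s = 2 * (z1 * (n2 * a3 - n3 * a2) + z2 * (n3 * a1 - n1 * a3) + z3 * (n1 * a2 - n2 * a1)) / D" and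
      "t = (2 * z1 * n3 - z2 * n2 + 2 * z3 * n1) / D"
    have rst: "D * r = 2 * (z1 * (b2 * n3 - b3 * n2) + z2 * (b3 * n1 - b1 * n3) + z3 * (b1 * n2 - b2 * n1))"
      "D * s = 2 * (z1 * (n2 * a3 - n3 * a2) + z2 * (n3 * a1 - n1 * a3) + z3 * (n1 * a2 - n2 * a1))"
      "D * t = 2 * z1 * n3 - z2 * n2 + 2 * z3 * n1"
      using D by (simp_all add: r_def s_def t_def)
    have "(r * a1 + s * b1 + t * n1, r * a2 + s * b2 + t * n2, r * a3 + s * b3 + t * n3) \<in> lin S"
      using lin_closed(3)[OF S a a] lin_closed(3)[OF S b b] lin_closed(3)[OF S n' n'] lin_closed(1)[OF S]
      by simp
    moreover have "D * (r * a1 + s * b1 + t * n1) = (D * r) * a1 + (D * s) * b1 + (D * t) * n1"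
      "D * (r * a2 + s * b2 + t * n2) = (D * r) * a2 + (D * s) * b2 + (D * t) * n2"
      "D * (r * a3 + s * b3 + t * n3) = (D * r) * a3 + (D * s) * b3 + (D * t) * n3"
      by (simp_all add: algebra_simps)
    then have "D * (r * a1 + s * b1 + t * n1) = D * z1" "D * (r * a2 + s * b2 + t * n2) = D * z2"
      "D * (r * a3 + s * b3 + t * n3) = D * z3"
      unfolding rst unfolding D_def n by algebra+
    ultimately show ?thesis using D by simp
  qed
  then show ?thesis by auto
qed

lemma lin_bracket_iff:
  "fst (bracket (elt x1 x2 x3 x4 y1 y2) (elt z1 z2 z3 z4 w1 w2)) = 0 \<longleftrightarrow>
    x1 * z2 = x2 * z1 \<and> x1 * z3 = x3 * z1 \<and> x2 * z3 = x3 * z2"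
  by simp

lemma lin_normal_form:
  assumes S: "subalgebra S"
  obtains p where "p \<in> aff_group"
    "lin (Ad p ` S) \<in> {{(0, 0, 0)}, {(x1, x2, x3). x2 = 0 \<and> x3 = 0}, {(x1, x2, x3). x1 = 0 \<and> x3 = 0},
      {(x1, x2, x3). x2 = 0 \<and> x3 = x1}, {(x1, x2, x3). x3 = 0}, UNIV}"
proof -
  consider (zero) "lin S = {(0, 0, 0)}"
    | (abelian) "lin S \<noteq> {(0, 0, 0)}" "\<And>X Y. X \<in> S \<Longrightarrow> Y \<in> S \<Longrightarrow> fst (bracket X Y) = 0"
    | (simple) X Y where "X \<in> S" "Y \<in> S" "disc (bracket X Y) \<noteq> 0"
    | (solvable) X Y where "X \<in> S" "Y \<in> S" "fst (bracket X Y) \<noteq> 0"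
      "\<And>X Y. X \<in> S \<Longrightarrow> Y \<in> S \<Longrightarrow> disc (bracket X Y) = 0"
    by metis
  then show ?thesis
  proof cases
    case zero
    have "Ad (mat 1, 0) ` S = S" by (simp add: Ad_id)
    with zero show ?thesis using that[of "(mat 1, 0)"] by simp
  next
    case abelian
    have "\<not> lin S \<subseteq> {(0, 0, 0)}" using abelian(1) lin_0[OF S] by blast
    then obtain x1 x2 x3 where x0: "(x1, x2, x3) \<in> lin S" and x1: "(x1, x2, x3) \<noteq> (0, 0, 0)"
      by (metis prod_cases3 singletonI subsetI)
    obtain x4 y1 y2 where x2: "elt x1 x2 x3 x4 y1 y2 \<in> S"
      using x0 by (rule linE)
    note x = x1 x2
    obtain p k k1 k2 k3 z1 z2 where p: "p \<in> aff_group" "k \<noteq> 0"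
      "(k1, k2, k3) \<in> {(1, 0, 0), (0, 1, 0), (1, 0, 1)}"
      "Ad p (elt x1 x2 x3 x4 y1 y2) = elt (k * k1) (k * k2) (k * k3) x4 z1 z2"
      using normalize_linear_part[OF x(1)] by metis
    let ?T = "Ad p ` S"
    have T: "subalgebra ?T" using S p(1) by (rule subalgebra_Ad[rotated])
    have "elt (k * k1) (k * k2) (k * k3) x4 z1 z2 \<in> ?T" using p(4) x(2) by (metis imageI)
    note kT = this linI[OF this]
    have k: "(t * k1, t * k2, t * k3) \<in> lin ?T" for t
      using lin_closed(3)[OF T kT(2) kT(2), of "t / k"] p(2) by simp
    \<comment> \<open>A trace-free matrix that commutes with a nonzero trace-free one is a multiple
      of it; the three equations express this proportionality.\<close>
    have comm: "k1 * w2 = k2 * w1 \<and> k1 * w3 = k3 * w1 \<and> k2 * w3 = k3 * w2" if ww: "(w1, w2, w3) \<in> lin ?T" for w1 w2 w3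
    proof -
      obtain w4 u1 u2 where w: "elt w1 w2 w3 w4 u1 u2 \<in> ?T" using ww by (rule linE)
      have "fst (bracket X Y) = 0" if "X \<in> ?T" "Y \<in> ?T" for X Y
        using that abelian(2) p(1) by (auto simp: bracket_Ad fst_Ad_0_iff)
      from this[OF kT(1) w] show ?thesis using p(2) unfolding lin_bracket_iff by (simp add: mult.assoc)
    qed
    have "lin ?T = range (\<lambda>t. (t * k1, t * k2, t * k3))"
    proof (intro subset_antisym subsetI)
      fix w assume "w \<in> lin ?T"
      moreover obtain w1 w2 w3 where "w = (w1, w2, w3)" by (cases w) auto
      ultimately show "w \<in> range (\<lambda>t. (t * k1, t * k2, t * k3))"
        using comm[of w1 w2 w3] p(3) by auto
    qed (use k in auto)
    moreover have "range (\<lambda>t. (t * k1, t * k2, t * k3)) \<in> {{(x1, x2, x3). x2 = 0 \<and> x3 = 0},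
        {(x1, x2, x3). x1 = 0 \<and> x3 = 0}, {(x1, x2, x3). x2 = 0 \<and> x3 = x1}}"
      using p(3) by (auto simp: image_def set_eq_iff)
    ultimately have "lin ?T \<in> {{(x1, x2, x3). x2 = 0 \<and> x3 = 0},
        {(x1, x2, x3). x1 = 0 \<and> x3 = 0}, {(x1, x2, x3). x2 = 0 \<and> x3 = x1}}"
      by (simp only:)
    then show ?thesis
      by (intro that[OF p(1)], elim insertE emptyE) (simp_all only: insert_iff simp_thms)
  next
    case simple
    obtain a1 a2 a3 a4 a5 a6 where X: "X = elt a1 a2 a3 a4 a5 a6" by (rule elt_exhaust)
    obtain b1 b2 b3 b4 b5 b6 where Y: "Y = elt b1 b2 b3 b4 b5 b6" by (rule elt_exhaust)
    have "lin S = UNIV"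
      using lin_eq_UNIV[OF S linI linI refl refl refl] simple unfolding X Y by simp
    moreover have "Ad (mat 1, 0) ` S = S" by (simp add: Ad_id)
    ultimately show ?thesis using that[of "(mat 1, 0)"] by simp
  next
    case solvable
    obtain x1 x2 x3 x4 y1 y2 where N: "bracket X Y = elt x1 x2 x3 x4 y1 y2" by (rule elt_exhaust)
    have x4: "x4 = 0" using N by (cases X rule: elt_exhaust; cases Y rule: elt_exhaust) simp
    have NS: "elt x1 x2 x3 x4 y1 y2 \<in> S" using subalgebra_bracket[OF S solvable(1,2)] N by simp
    have "(x1, x2, x3) \<noteq> (0, 0, 0)" using solvable(3) unfolding N by (simp add: x4)
    then obtain p k k1 k2 k3 z1 z2 where p: "p \<in> aff_group" "k \<noteq> 0"
      "(k1, k2, k3) \<in> {(1, 0, 0), (0, 1, 0), (1, 0, 1)}"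
      "Ad p (elt x1 x2 x3 x4 y1 y2) = elt (k * k1) (k * k2) (k * k3) x4 z1 z2"
      using normalize_linear_part by metis
    have "disc (elt (k * k1) (k * k2) (k * k3) x4 z1 z2) = 0"
      using solvable(4)[OF solvable(1,2)] disc_Ad[OF p(1)] unfolding N p(4)[symmetric] by simp
    then have k: "k1 = 1" "k2 = 0" "k3 = 0" using p(2,3) by auto
    let ?T = "Ad p ` S"
    have T: "subalgebra ?T" using S p(1) by (rule subalgebra_Ad[rotated])
    have "elt k 0 0 x4 z1 z2 \<in> ?T" using p(4) NS unfolding k by (metis imageI mult.right_neutral mult_zero_right)
    note kT = this linI[OF this]
    have e1: "(t, 0, 0) \<in> lin ?T" for t
      using lin_closed(3)[OF T kT(2) kT(2), of "t / k"] p(2) by simp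
    \<comment> \<open>The discriminant of the bracket with \<open>k e\<^sub>1\<close> is
      \<open>(2 k w3)^2\<close>, so nilpotency of all brackets forces triangularity.\<close>
    have w3: "w3 = 0" if ww: "(w1, w2, w3) \<in> lin ?T" for w1 w2 w3
    proof -
      obtain w4 u1 u2 where w: "elt w1 w2 w3 w4 u1 u2 \<in> ?T" using ww by (rule linE)
      have "disc (bracket X Y) = 0" if "X \<in> ?T" "Y \<in> ?T" for X Y
        using that solvable(4) p(1) by (auto simp: bracket_Ad disc_Ad)
      from this[OF kT(1) w] show ?thesis using p(2) by simp
    qed
    obtain a1 a2 a3 a4 a5 a6 where X: "Ad p X = elt a1 a2 a3 a4 a5 a6" by (rule elt_exhaust)
    obtain b1 b2 b3 b4 b5 b6 where Y: "Ad p Y = elt b1 b2 b3 b4 b5 b6" by (rule elt_exhaust)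
    have a: "(a1, a2, a3) \<in> lin ?T" and b: "(b1, b2, b3) \<in> lin ?T"
      using solvable(1,2) X Y by (metis imageI linI)+
    have "fst (bracket (Ad p X) (Ad p Y)) \<noteq> 0"
      using solvable(3) p(1) by (simp add: bracket_Ad fst_Ad_0_iff)
    \<comment> \<open>Otherwise both linear parts would be multiples of \<open>e\<^sub>1\<close>
      modulo scalars and would commute.\<close>
    then have "a2 \<noteq> 0 \<or> b2 \<noteq> 0"
      using w3[OF a] w3[OF b] unfolding X Y lin_bracket_iff by auto
    then obtain c1 c2 where c: "(c1, c2, 0) \<in> lin ?T" "c2 \<noteq> 0"
      using a b w3[OF a] w3[OF b] by metis
    have "(t1, t2, 0) \<in> lin ?T" for t1 t2
      using lin_closed(1)[OF T lin_closed(3)[OF T c(1) c(1), of "t2 / c2"] e1[of "t1 - t2 / c2 * c1"]] c(2)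
      by simp
    then have "lin ?T = {(x1, x2, x3). x3 = 0}" using w3 by auto
    then show ?thesis using that[OF p(1)] by simp
  qed
qed

lemma other_labels:
  "S1_1 \<in> labels" "S1_3 \<in> labels" "S1_5 \<in> labels" "S1_7 a \<in> labels"
  "S2_1 \<in> labels" "S2_3 \<in> labels" "S2_6 \<in> labels" "S2_8 \<in> labels" "S2_9 \<in> labels"
  "S2_10 \<in> labels" "S2_11 a \<in> labels" "S2_12 \<in> labels" "S2_13 \<in> labels"
  "S3_1 \<in> labels" "S3_2 \<in> labels" "S3_5 a \<in> labels" "S3_6 \<in> labels" "S3_7 \<in> labels"
  "S3_8 a \<in> labels" "S3_9 \<in> labels" "S3_10 \<in> labels" "S3_11 \<in> labels" "S3_12 \<in> labels"
  "S4_1 \<in> labels" "S4_2 \<in> labels" "S4_3 \<in> labels" "S4_4 a \<in> labels" "S4_5 \<in> labels" "S4_6 \<in> labels"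
  "S5_1 \<in> labels" "S5_2 \<in> labels"
  by (simp_all add: labels_def labels_1D_def labels_2D_def labels_3D_def labels_4D_def labels_5D_def)

section \<open>Translations and lifts\<close>

lemma trans_part_closed:
  assumes "subalgebra S" "(v1, v2) \<in> trans_part S" "(w1, w2) \<in> trans_part S"
  shows "(k * v1 + m * w1, k * v2 + m * w2) \<in> trans_part S"
  using assms subalgebra_add[OF assms(1) subalgebra_scale[OF assms(1)] subalgebra_scale[OF assms(1)],
      of "elt 0 0 0 0 v1 v2" "elt 0 0 0 0 w1 w2" k m]
  by (simp add: trans_part_def)

lemma trans_part_0: "subalgebra S \<Longrightarrow> (0, 0) \<in> trans_part S"
  by (simp add: trans_part_def subalgebra_def subspace_0 flip: elt_0)

lemma trans_part_cases:
  assumes S: "subalgebra S"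
  obtains (zero) "trans_part S = {(0, 0)}"
    | (line) v1 v2 where "(v1, v2) \<noteq> (0, 0)" "trans_part S = {(y1, y2). v1 * y2 = v2 * y1}"
    | (all) "trans_part S = UNIV"
proof (cases "trans_part S \<subseteq> {(0, 0)}")
  case True
  then show ?thesis using zero trans_part_0[OF S] by blast
next
  case False
  then obtain v1 v2 where v: "(v1, v2) \<in> trans_part S" "(v1, v2) \<noteq> (0, 0)" by auto
  show ?thesis
  proof (cases "trans_part S \<subseteq> {(y1, y2). v1 * y2 = v2 * y1}")
    case True
    have "(y1, y2) \<in> trans_part S" if "v1 * y2 = v2 * y1" for y1 y2
    proof (cases "v1 = 0")
      case True
      then show ?thesis
        using that v(2) trans_part_closed[OF S v(1) v(1), of "y2 / v2" 0] by simp
    next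
      case False
      then have "y2 = v2 * y1 / v1" using that by (simp add: field_simps)
      then show ?thesis
        using False trans_part_closed[OF S v(1) v(1), of "y1 / v1" 0] by (simp add: mult.commute)
    qed
    with True v(2) show ?thesis by (intro line) auto
  next
    case False
    then obtain w1 w2 where w: "(w1, w2) \<in> trans_part S" "v1 * w2 - v2 * w1 \<noteq> 0" by auto
    define D where "D = v1 * w2 - v2 * w1"
    have "(y1, y2) \<in> trans_part S" for y1 y2
    proof -
      have "(y1 * w2 - y2 * w1) / D * v1 + (v1 * y2 - v2 * y1) / D * w1 = D * y1 / D"
        "(y1 * w2 - y2 * w1) / D * v2 + (v1 * y2 - v2 * y1) / D * w2 = D * y2 / D"
        unfolding times_divide_eq_left add_divide_distrib[symmetric] by (simp_all add: D_def algebra_simps)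
      then show ?thesis
        using trans_part_closed[OF S v(1) w(1), of "(y1 * w2 - y2 * w1) / D" "(v1 * y2 - v2 * y1) / D"] w(2)
        by (simp add: D_def)
    qed
    then show ?thesis by (intro all) auto
  qed
qed

lemma trans_part_invariant:
  assumes S: "subalgebra S" and x: "elt x1 x2 x3 x4 y1 y2 \<in> S" and v: "(v1, v2) \<in> trans_part S"
  shows "((x4 + x2) / 2 * v1 - x3 * v2, x1 * v1 + (x4 - x2) / 2 * v2) \<in> trans_part S"
  using subalgebra_bracket[OF S x trans_partD[OF v]] by (simp add: trans_part_def)

text \<open>An invariant line consists of eigenvectors.\<close>

lemma invariant_line:
  assumes "subalgebra S" "trans_part S = {(y1, y2). v1 * y2 = v2 * y1}" "(x1, x2, x3) \<in> lin S"
  shows "x1 * v1\<^sup>2 - x2 * (v1 * v2) + x3 * v2\<^sup>2 = 0"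
proof -
  obtain x4 y1 y2 where "elt x1 x2 x3 x4 y1 y2 \<in> S" using assms(3) by (rule linE)
  from trans_part_invariant[OF assms(1) this, of v1 v2]
  have "v1 * (x1 * v1 + (x4 - x2) / 2 * v2) = v2 * ((x4 + x2) / 2 * v1 - x3 * v2)"
    unfolding assms(2) by simp
  then show ?thesis by (simp add: power2_eq_square field_simps)
qed

text \<open>Two elements with the same trace-free part differ by a scalar part and a translation.
  Without dilations the scalar part vanishes, so the fibre over a point of \<open>lin S\<close> is a
  coset of the translations.\<close>

lemma mem_lift_iff:
  assumes S: "subalgebra S" and "\<And>x4 y1 y2. elt 0 0 0 x4 y1 y2 \<in> S \<Longrightarrow> x4 = 0"
    and lift: "elt x1 x2 x3 c q1 q2 \<in> S"
  shows "elt x1 x2 x3 x4 y1 y2 \<in> S \<longleftrightarrow> x4 = c \<and> (y1 - q1, y2 - q2) \<in> trans_part S"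
proof
  assume "elt x1 x2 x3 x4 y1 y2 \<in> S"
  from subalgebra_diff[OF S this lift] assms(2) show "x4 = c \<and> (y1 - q1, y2 - q2) \<in> trans_part S"
    by (force simp: trans_part_def)
next
  assume "x4 = c \<and> (y1 - q1, y2 - q2) \<in> trans_part S"
  then show "elt x1 x2 x3 x4 y1 y2 \<in> S"
    using subalgebra_add[OF S lift, of "elt 0 0 0 0 (y1 - q1) (y2 - q2)"] by (simp add: trans_part_def)
qed

text \<open>The bracket with \<open>e\<^sub>4\<close> kills the linear part and halves the
  translation. Hence \<open>S\<close> contains the translational part of each of its elements, and
  no cocycle remains.\<close>

lemma mem_dilation_iff:
  assumes S: "subalgebra S" and e: "elt 0 0 0 1 0 0 \<in> S"
  shows "elt x1 x2 x3 x4 y1 y2 \<in> S \<longleftrightarrow> (x1, x2, x3) \<in> lin S \<and> (y1, y2) \<in> trans_part S"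
proof -
  have trans: "(y1, y2) \<in> trans_part S" if "elt x1 x2 x3 x4 y1 y2 \<in> S" for x1 x2 x3 x4 y1 y2
    using subalgebra_scale[OF S subalgebra_bracket[OF S e that], of 2] by (simp add: trans_part_def)
  show ?thesis
  proof (intro iffI conjI; (elim conjE)?)
    assume "(x1, x2, x3) \<in> lin S" and y: "(y1, y2) \<in> trans_part S"
    then obtain c q1 q2 where q: "elt x1 x2 x3 c q1 q2 \<in> S" by (metis linE)
    have "elt 0 0 0 0 (y1 - q1) (y2 - q2) \<in> S"
      using trans_part_closed[OF S y trans[OF q], of 1 "- 1"] by (simp add: trans_part_def)
    from subalgebra_add[OF S subalgebra_add[OF S q this] subalgebra_scale[OF S e, of "x4 - c"]]
    show "elt x1 x2 x3 x4 y1 y2 \<in> S" by simp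
  qed (use trans linI in auto)
qed

lemma lin_shift: "lin (Ad (mat 1, vector [u1, u2]) ` S) = lin S"
proof (intro set_eqI iffI; clarify)
  fix x1 x2 x3
  assume "(x1, x2, x3) \<in> lin S"
  then obtain x4 y1 y2 where "elt x1 x2 x3 x4 y1 y2 \<in> S" by (rule linE)
  from imageI[OF this, of "Ad (mat 1, vector [u1, u2])"]
  show "(x1, x2, x3) \<in> lin (Ad (mat 1, vector [u1, u2]) ` S)"
    unfolding Ad_shift by (rule linI)
next
  fix x1 x2 x3
  assume "(x1, x2, x3) \<in> lin (Ad (mat 1, vector [u1, u2]) ` S)"
  then obtain x4 y1 y2 X where *: "elt x1 x2 x3 x4 y1 y2 = Ad (mat 1, vector [u1, u2]) X" "X \<in> S"
    by (metis linE imageE)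
  obtain z1 z2 z3 z4 w1 w2 where X: "X = elt z1 z2 z3 z4 w1 w2" by (rule elt_exhaust)
  from * show "(x1, x2, x3) \<in> lin S"
    unfolding X Ad_shift by (auto intro: linI)
qed

text \<open>The matrix is a rotation with scaling that sends \<open>v\<close> to a positive multiple
  of the first basis vector.\<close>

lemma Ad_rotate_line:
  fixes v1 v2 :: real
  assumes "(v1, v2) \<noteq> (0, 0)"
  shows "(mat2 v1 v2 (- v2) v1, vector [0, 0]) \<in> aff_group"
    "Ad (mat2 v1 v2 (- v2) v1, vector [0, 0]) (elt 0 0 0 x4 y1 y2) =
      elt 0 0 0 x4 (v1 * y1 + v2 * y2) (v1 * y2 - v2 * y1)"
proof -
  have D: "v1 * v1 + v2 * v2 > 0"
    using assms sum_squares_gt_zero_iff[of v1 v2] by auto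
  then show "(mat2 v1 v2 (- v2) v1, vector [0, 0]) \<in> aff_group"
    by (simp add: aff_group_def)
  show "Ad (mat2 v1 v2 (- v2) v1, vector [0, 0]) (elt 0 0 0 x4 y1 y2) =
      elt 0 0 0 x4 (v1 * y1 + v2 * y2) (v1 * y2 - v2 * y1)"
    using Ad_elt[of v1 v1 v2 "- v2" 0 0 0 0 0 x4 y1 y2] assms D by simp
qed

text \<open>If all linear parts are scalar, no direction is distinguished and the line of
  translations can be rotated onto the first axis. The predicate \<open>P\<close> covers the line
  alone and the line together with the dilation.\<close>

lemma classified_scalar_line:
  assumes l: "l \<in> labels" and v: "(v1, v2) \<noteq> (0, 0)"
    and S: "\<And>x1 x2 x3 x4 y1 y2. elt x1 x2 x3 x4 y1 y2 \<in> S \<longleftrightarrow>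
      x1 = 0 \<and> x2 = 0 \<and> x3 = 0 \<and> P x4 \<and> v1 * y2 = v2 * y1"
    and subalg: "\<And>x1 x2 x3 x4 y1 y2. elt x1 x2 x3 x4 y1 y2 \<in> subalg l \<longleftrightarrow>
      x1 = 0 \<and> x2 = 0 \<and> x3 = 0 \<and> P x4 \<and> y2 = 0"
  shows "classified S"
proof -
  let ?p = "(mat2 v1 v2 (- v2) v1, vector [0, 0])"
  note Ad = Ad_rotate_line(2)[OF v]
  have D: "v1 * v1 + v2 * v2 \<noteq> 0"
    using v by (simp add: sum_squares_eq_zero_iff)
  have "Ad ?p ` S = subalg l"
  proof (intro subset_antisym subsetI)
    fix X assume "X \<in> Ad ?p ` S"
    then obtain Y where Y: "X = Ad ?p Y" "Y \<in> S" by blast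
    then show "X \<in> subalg l" by (cases Y rule: elt_exhaust) (auto simp: S subalg Ad)
  next
    fix X assume X: "X \<in> subalg l"
    obtain x1 x2 x3 x4 y1 y2 where x: "X = elt x1 x2 x3 x4 y1 y2" by (rule elt_exhaust)
    let ?t = "y1 / (v1 * v1 + v2 * v2)"
    have "v1 * (v1 * ?t) + v2 * (v2 * ?t) = (v1 * v1 + v2 * v2) * ?t"
      by (simp only: distrib_right mult.assoc)
    also have "\<dots> = y1" using D by simp
    finally have "Ad ?p (elt 0 0 0 x4 (v1 * ?t) (v2 * ?t)) = X"
      using X unfolding Ad x subalg by simp
    moreover have "elt 0 0 0 x4 (v1 * ?t) (v2 * ?t) \<in> S"
      using X unfolding x subalg S by simp
    ultimately show "X \<in> Ad ?p ` S" by (metis imageI)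
  qed
  then show ?thesis
    using l Ad_rotate_line(1)[OF v] unfolding classified_def equivalent_def Inn_def by blast
qed

section \<open>Subalgebras containing a dilation\<close>

lemma classified_dilation:
  assumes S: "subalgebra S" and e: "elt 0 0 0 1 0 0 \<in> S" and "S \<noteq> UNIV"
    and lin: "lin S \<in> {{(0, 0, 0)}, {(x1, x2, x3). x2 = 0 \<and> x3 = 0}, {(x1, x2, x3). x1 = 0 \<and> x3 = 0},
      {(x1, x2, x3). x2 = 0 \<and> x3 = x1}, {(x1, x2, x3). x3 = 0}, UNIV}"
  shows "classified S"
proof -
  note mem = mem_dilation_iff[OF S e]
  have not_all: "\<not> (lin S = UNIV \<and> trans_part S = UNIV)"
  proof
    assume "lin S = UNIV \<and> trans_part S = UNIV"
    then have "X \<in> S" for X by (cases X rule: elt_exhaust) (simp add: mem)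
    with assms(3) show False by blast
  qed
  from S show ?thesis
  proof (cases rule: trans_part_cases)
    case zero
    from lin show ?thesis
    proof (elim insertE emptyE)
      assume "lin S = {(0, 0, 0)}"
      then show ?thesis by (intro classified_subalg[of S1_3]) (auto simp: other_labels mem zero)
    next
      assume "lin S = {(x1, x2, x3). x2 = 0 \<and> x3 = 0}"
      then show ?thesis by (intro classified_subalg[of S2_8]) (auto simp: other_labels mem zero)
    next
      assume "lin S = {(x1, x2, x3). x1 = 0 \<and> x3 = 0}"
      then show ?thesis by (intro classified_subalg[of S2_9]) (auto simp: other_labels mem zero)
    next
      assume "lin S = {(x1, x2, x3). x2 = 0 \<and> x3 = x1}"
      then show ?thesis by (intro classified_subalg[of S2_10]) (auto simp: other_labels mem zero)
    next
      assume "lin S = {(x1, x2, x3). x3 = 0}"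
      then show ?thesis by (intro classified_subalg[of S3_11]) (auto simp: other_labels mem zero)
    next
      assume "lin S = UNIV"
      then show ?thesis by (intro classified_subalg[of S4_6]) (auto simp: other_labels mem zero)
    qed
  next
    case all
    from lin show ?thesis
    proof (elim insertE emptyE)
      assume "lin S = {(0, 0, 0)}"
      then show ?thesis by (intro classified_subalg[of S3_2]) (auto simp: other_labels mem all)
    next
      assume "lin S = {(x1, x2, x3). x2 = 0 \<and> x3 = 0}"
      then show ?thesis by (intro classified_subalg[of S4_1]) (auto simp: other_labels mem all)
    next
      assume "lin S = {(x1, x2, x3). x1 = 0 \<and> x3 = 0}"
      then show ?thesis by (intro classified_subalg[of S4_2]) (auto simp: other_labels mem all)
    next
      assume "lin S = {(x1, x2, x3). x2 = 0 \<and> x3 = x1}"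
      then show ?thesis by (intro classified_subalg[of S4_3]) (auto simp: other_labels mem all)
    next
      assume "lin S = {(x1, x2, x3). x3 = 0}"
      then show ?thesis by (intro classified_subalg[of S5_1]) (auto simp: other_labels mem all)
    next
      assume "lin S = UNIV"
      then show ?thesis using not_all all by simp
    qed
  next
    case (line v1 v2)
    note inv = invariant_line[OF S line(2)]
    from lin show ?thesis
    proof (elim insertE emptyE)
      assume l: "lin S = {(0, 0, 0)}"
      show ?thesis
        by (rule classified_scalar_line[of S2_3 v1 v2 S "\<lambda>x4. True"])
           (use line in \<open>auto simp: other_labels mem l\<close>)
    next
      assume l: "lin S = {(x1, x2, x3). x2 = 0 \<and> x3 = 0}"
      have "v1 = 0" using inv[of 1 0 0] unfolding l by simp
      then show ?thesis using line(1) by (intro classified_subalg[of S3_6]) (auto simp: other_labels mem l line(2))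
    next
      assume l: "lin S = {(x1, x2, x3). x1 = 0 \<and> x3 = 0}"
      have "v1 * v2 = 0" using inv[of 0 1 0] unfolding l by simp
      then consider "v2 = 0" "v1 \<noteq> 0" | "v1 = 0" "v2 \<noteq> 0" using line(1) by auto
      then show ?thesis
      proof cases
        case 1
        then show ?thesis by (intro classified_subalg[of S3_7]) (auto simp: other_labels mem l line(2))
      next
        case 2
        \<comment> \<open>The quarter turn preserves the diagonal linear part and moves the second
          axis to the first.\<close>
        then show ?thesis
          by (intro classifiedI[of "(mat2 0 (- 1) 1 0, vector [0, 0])" S3_7])
             (auto simp: other_labels mem l line(2) Ad_rotate)
      qed
    next
      assume l: "lin S = {(x1, x2, x3). x2 = 0 \<and> x3 = x1}"
      \<comment> \<open>An elliptic linear part has no real eigenvector.\<close>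
      have "v1\<^sup>2 + v2\<^sup>2 = 0" using inv[of 1 0 1] unfolding l by simp
      with line(1) show ?thesis by simp
    next
      assume l: "lin S = {(x1, x2, x3). x3 = 0}"
      have "v1 = 0" using inv[of 1 0 0] unfolding l by simp
      then show ?thesis using line(1) by (intro classified_subalg[of S4_5]) (auto simp: other_labels mem l line(2))
    next
      assume l: "lin S = UNIV"
      have "v1\<^sup>2 + v2\<^sup>2 = 0" using inv[of 1 0 1] unfolding l by simp
      with line(1) show ?thesis by simp
    qed
  qed
qed

section \<open>Subalgebras without a dilation\<close>

lemma square_pos_iff: "0 < x * x \<longleftrightarrow> x \<noteq> (0 :: real)"
  using not_real_square_gt_zero[of x] by blast

locale dilation_free =
  fixes S :: "aff2 set"
  assumes S: "subalgebra S"
    and no_dilation: "\<And>x4 y1 y2. elt 0 0 0 x4 y1 y2 \<in> S \<Longrightarrow> x4 = 0"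
begin

text \<open>The functions \<open>c\<close>, \<open>q1\<close>, \<open>q2\<close> give a section of
  the projection onto \<open>lin S\<close>; in the applications it is the linear one determined by
  lifts of basis vectors.\<close>

lemma mem_iff:
  assumes "\<And>x1 x2 x3. (x1, x2, x3) \<in> lin S \<Longrightarrow> elt x1 x2 x3 (c x1 x2 x3) (q1 x1 x2 x3) (q2 x1 x2 x3) \<in> S"
  shows "elt x1 x2 x3 x4 y1 y2 \<in> S \<longleftrightarrow> (x1, x2, x3) \<in> lin S \<and> x4 = c x1 x2 x3 \<and>
    (y1 - q1 x1 x2 x3, y2 - q2 x1 x2 x3) \<in> trans_part S"
proof (cases "(x1, x2, x3) \<in> lin S")
  case True
  then show ?thesis using mem_lift_iff[OF S no_dilation assms[OF True]] by simp
next
  case False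
  then show ?thesis by (auto intro: linI)
qed

lemma lift:
  assumes "elt x1 x2 x3 c q1 q2 \<in> S"
  shows "elt x1 x2 x3 x4 y1 y2 \<in> S \<longleftrightarrow> x4 = c \<and> (y1 - q1, y2 - q2) \<in> trans_part S"
  using mem_lift_iff[OF S no_dilation assms] .

lemma classified_trivial:
  assumes l: "lin S = {(0, 0, 0)}" and "S \<noteq> {0}"
  shows "classified S"
proof -
  have "0 \<in> S" using S by (simp add: subalgebra_def subspace_0)
  then have mem: "elt x1 x2 x3 x4 y1 y2 \<in> S \<longleftrightarrow> x1 = 0 \<and> x2 = 0 \<and> x3 = 0 \<and> x4 = 0 \<and> (y1, y2) \<in> trans_part S"
    for x1 x2 x3 x4 y1 y2
    using mem_iff[of "\<lambda>_ _ _. 0" "\<lambda>_ _ _. 0" "\<lambda>_ _ _. 0"] by (simp add: l flip: elt_0)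
  from S show ?thesis
  proof (cases rule: trans_part_cases)
    case zero
    have "X \<in> S \<longleftrightarrow> X = 0" for X
      by (cases X rule: elt_exhaust) (simp add: mem zero)
    with assms(2) show ?thesis by blast
  next
    case (line v1 v2)
    show ?thesis
      by (rule classified_scalar_line[of S1_1 v1 v2 S "\<lambda>x4. x4 = 0"])
         (use line in \<open>auto simp: other_labels mem\<close>)
  next
    case all
    then show ?thesis by (intro classified_subalg[of S2_1]) (auto simp: other_labels mem)
  qed
qed

lemma classified_nilpotent:
  assumes l: "lin S = {(x1, x2, x3). x2 = 0 \<and> x3 = 0}"
  shows "classified S"
proof -
  have "(1, 0, 0) \<in> lin S" by (simp add: l)
  then obtain c p q where "elt 1 0 0 c p q \<in> S" by (rule linE)
  from subalgebra_scale[OF S this]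
  have mem: "elt x1 x2 x3 x4 y1 y2 \<in> S \<longleftrightarrow> x2 = 0 \<and> x3 = 0 \<and> x4 = c * x1 \<and>
      (y1 - p * x1, y2 - q * x1) \<in> trans_part S" for x1 x2 x3 x4 y1 y2
    using mem_iff[of "\<lambda>x _ _. c * x" "\<lambda>x _ _. p * x" "\<lambda>x _ _. q * x"] by (simp add: l mult.commute)
  \<comment> \<open>Conjugation by a diagonal matrix of positive determinant can rescale
    \<open>c\<close> by a positive factor, so its sign is all that remains.\<close>
  define \<epsilon> where "\<epsilon> = sgn c"
  have \<epsilon>: "\<epsilon> * \<bar>c\<bar> = c" "c \<noteq> 0 \<Longrightarrow> \<epsilon> = - 1 \<or> \<epsilon> = 1"
    by (simp_all add: \<epsilon>_def sgn_mult_abs sgn_real_def)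
  define a where "a = sgn p"
  have a: "p \<noteq> 0 \<Longrightarrow> a * p > 0" "p \<noteq> 0 \<Longrightarrow> a * a = 1" "p \<noteq> 0 \<Longrightarrow> a \<noteq> 0"
    by (simp_all add: a_def sgn_real_def)
  have pa: "p \<noteq> 0 \<Longrightarrow> p / a = a * p"
    using a(2,3) by (simp add: field_simps)
  from S show ?thesis
  proof (cases rule: trans_part_cases)
    case zero
    consider "c \<noteq> 0" | "c = 0" "p = 0" | "c = 0" "p \<noteq> 0" by blast
    then show ?thesis
    proof cases
      case 1
      \<comment> \<open>The coordinate of \<open>e\<^sub>1\<close> is multiplied by
        \<open>d / a = \<bar>c\<bar>\<close>, which turns the ratio of \<open>x4\<close> to it into
        \<open>\<epsilon>\<close>. Since \<open>c \<noteq> 0\<close>, the linear part is invertible,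
        and the vector \<open>u\<close> solves the equations that make the translational part
        vanish.\<close>
      show ?thesis
        by (rule classifiedI[of "(mat2 1 0 0 \<bar>c\<bar>, vector [2 * p / c, 2 * \<bar>c\<bar> * (q - 2 * p / c) / c])" "S1_6 \<epsilon>"])
           (use 1 \<epsilon> in \<open>auto simp: parameters_labels mem zero Ad_diag field_simps\<close>)
    next
      case 2
      show ?thesis
        by (rule classifiedI[of "(mat 1, vector [q, 0])" "S1_2 0"])
           (use 2 in \<open>auto simp: parameters_labels mem zero Ad_shift field_simps\<close>)
    next
      case 3
      \<comment> \<open>Taking \<open>a = sgn p\<close> and \<open>d = p\<close> makes the
        determinant, the factor of \<open>e\<^sub>1\<close> and the new coefficient of
        \<open>f\<^sub>1\<close> all equal to \<open>\<bar>p\<bar>\<close>; the translation removes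
        the component along \<open>f\<^sub>2\<close>, the image of \<open>e\<^sub>1\<close>.\<close>
      show ?thesis
        by (rule classifiedI[of "(mat2 a 0 0 p, vector [a * q, 0])" "S1_2 1"])
           (use 3 a pa in \<open>auto simp: parameters_labels mem zero Ad_diag\<close>)
    qed
  next
    case (line v1 v2)
    have "v1 = 0" using invariant_line[OF S line(2), of 1 0 0] by (simp add: l)
    then have trans: "trans_part S = {(y1, y2). y1 = 0}" using line by auto
    consider "c \<noteq> 0" | "c = 0" "p = 0" | "c = 0" "p \<noteq> 0" by blast
    then show ?thesis
    proof cases
      case 1
      show ?thesis
        by (rule classifiedI[of "(mat2 1 0 0 \<bar>c\<bar>, vector [2 * p / c, 0])" "S2_7 \<epsilon>"])
           (use 1 \<epsilon> in \<open>auto simp: parameters_labels mem trans Ad_diag field_simps\<close>)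
    next
      case 2
      show ?thesis
        by (rule classified_subalg[of "S2_2 0"]) (use 2 in \<open>auto simp: parameters_labels mem trans\<close>)
    next
      case 3
      show ?thesis
        by (rule classifiedI[of "(mat2 a 0 0 p, vector [0, 0])" "S2_2 1"])
           (use 3 a pa in \<open>auto simp: parameters_labels mem trans Ad_diag\<close>)
    qed
  next
    case all
    show ?thesis
    proof (cases "c = 0")
      case True
      then show ?thesis by (intro classified_subalg[of S3_1]) (auto simp: other_labels mem all)
    next
      case False
      then show ?thesis
        by (intro classifiedI[of "(mat2 1 0 0 \<bar>c\<bar>, vector [0, 0])" "S3_4 \<epsilon>"])
           (use \<epsilon> in \<open>auto simp: parameters_labels mem all Ad_diag field_simps\<close>)
    qed
  qed
qed

lemma classified_elliptic:
  assumes l: "lin S = {(x1, x2, x3). x2 = 0 \<and> x3 = x1}"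
  shows "classified S"
proof -
  have "(1, 0, 1) \<in> lin S" by (simp add: l)
  then obtain c p q where "elt 1 0 1 c p q \<in> S" by (rule linE)
  from subalgebra_scale[OF S this]
  have mem: "elt x1 x2 x3 x4 y1 y2 \<in> S \<longleftrightarrow> x2 = 0 \<and> x3 = x1 \<and> x4 = c * x1 \<and>
      (y1 - p * x1, y2 - q * x1) \<in> trans_part S" for x1 x2 x3 x4 y1 y2
    using mem_iff[of "\<lambda>x _ _. c * x" "\<lambda>x _ _. p * x" "\<lambda>x _ _. q * x"] by (simp add: l mult.commute)
  from S show ?thesis
  proof (cases rule: trans_part_cases)
    case zero
    \<comment> \<open>\<open>D\<close> is four times the determinant of the generator, which is thus
      invertible; \<open>u\<close> is the solution by Cramer's rule of the two equations established
      at the end.\<close>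
    define D where "D = 4 + c * c"
    have D: "D \<noteq> 0" using zero_le_square[of c] unfolding D_def by linarith
    define u1 u2 where "u1 = (2 * c * p + 4 * q) / D" and "u2 = (2 * c * q - 4 * p) / D"
    have Du: "D * u1 = 2 * c * p + 4 * q" "D * u2 = 2 * c * q - 4 * p"
      using D by (simp_all add: u1_def u2_def)
    have "D * (c / 2 * u1 - u2) = c / 2 * (D * u1) - D * u2" "D * (u1 + c / 2 * u2) = D * u1 + c / 2 * (D * u2)"
      by (simp_all add: algebra_simps)
    then have "D * (c / 2 * u1 - u2) = D * p" "D * (u1 + c / 2 * u2) = D * q"
      unfolding Du by (simp_all add: D_def algebra_simps)
    then have u: "p = c / 2 * u1 - u2" "q = u1 + c / 2 * u2" using D by simp_all
    show ?thesis
      by (rule classifiedI[of "(mat 1, vector [u1, u2])" "S1_7 c"])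
         (auto simp: other_labels mem zero Ad_shift u algebra_simps)
  next
    case (line v1 v2)
    have "v1\<^sup>2 + v2\<^sup>2 = 0" using invariant_line[OF S line(2), of 1 0 1] by (simp add: l)
    with line(1) show ?thesis by simp
  next
    case all
    then show ?thesis by (intro classified_subalg[of "S3_5 c"]) (auto simp: other_labels mem)
  qed
qed

lemma classified_simple:
  assumes l: "lin S = UNIV"
  shows "classified S"
proof -
  obtain c1 p1 q1 where 1: "elt 1 0 0 c1 p1 q1 \<in> S" using l by (metis UNIV_I linE)
  obtain c2 p2 q2 where 2: "elt 0 1 0 c2 p2 q2 \<in> S" using l by (metis UNIV_I linE)
  obtain c3 p3 q3 where 3: "elt 0 0 1 c3 p3 q3 \<in> S" using l by (metis UNIV_I linE)
  have b1: "elt 1 0 0 0 (c1 / 2 * p2 - (c2 + 1) / 2 * p1) (p2 + c1 / 2 * q2 - (c2 - 1) / 2 * q1) \<in> S"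
    using subalgebra_bracket[OF S 1 2] by simp
  have b2: "elt 0 2 0 0 (c1 / 2 * p3 - c3 / 2 * p1 + q1) (p3 + c1 / 2 * q3 - c3 / 2 * q1) \<in> S"
    using subalgebra_bracket[OF S 1 3] by simp
  have b3: "elt 0 0 1 0 ((c2 + 1) / 2 * p3 - c3 / 2 * p2 + q2) ((c2 - 1) / 2 * q3 - c3 / 2 * q2) \<in> S"
    using subalgebra_bracket[OF S 2 3] by simp
  have 22: "elt 0 2 0 (2 * c2) (2 * p2) (2 * q2) \<in> S"
    using subalgebra_scale[OF S 2, of 2] by simp
  \<comment> \<open>The brackets are again lifts of \<open>e\<^sub>1\<close>,
    \<open>2 e\<^sub>2\<close> and \<open>e\<^sub>3\<close> but have trace zero, and the trace of a
    lift is unique.\<close>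
  have c: "c1 = 0" "c2 = 0" "c3 = 0"
    using b1 b2 b3 unfolding lift[OF 1] lift[OF 22] lift[OF 3] by auto
  \<comment> \<open>The cocycle identities: the bracket of two lifts and the lift of the bracket
    differ by a translation in \<open>S\<close>.\<close>
  have t: "(- (3 / 2) * p1, p2 - q1 / 2) \<in> trans_part S" "(q1 - 2 * p2, p3 - 2 * q2) \<in> trans_part S"
    "(q2 - p3 / 2, - (3 / 2) * q3) \<in> trans_part S"
    using b1 b2 b3 unfolding lift[OF 1] lift[OF 22] lift[OF 3] by (simp_all add: c field_simps)
  have "elt x1 x2 x3 0 (p1 * x1 + p2 * x2 + p3 * x3) (q1 * x1 + q2 * x2 + q3 * x3) \<in> S" for x1 x2 x3
    using subalgebra_add[OF S subalgebra_add[OF S subalgebra_scale[OF S 1] subalgebra_scale[OF S 2]]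
        subalgebra_scale[OF S 3], of x1 x2 x3]
    by (simp add: c mult.commute)
  then have mem: "elt x1 x2 x3 x4 y1 y2 \<in> S \<longleftrightarrow> x4 = 0 \<and>
      (y1 - (p1 * x1 + p2 * x2 + p3 * x3), y2 - (q1 * x1 + q2 * x2 + q3 * x3)) \<in> trans_part S"
    for x1 x2 x3 x4 y1 y2
    using mem_iff[of "\<lambda>_ _ _. 0" "\<lambda>x1 x2 x3. p1 * x1 + p2 * x2 + p3 * x3" "\<lambda>x1 x2 x3. q1 * x1 + q2 * x2 + q3 * x3"]
    by (simp add: l)
  from S show ?thesis
  proof (cases rule: trans_part_cases)
    case zero
    then have pq: "p1 = 0" "q3 = 0" "q1 = 2 * p2" "p3 = 2 * q2" using t by auto
    \<comment> \<open>The identities leave \<open>q1\<close> and \<open>p3\<close> free, and every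
      such cocycle is the coboundary of \<open>(q1, - p3)\<close>, so a translation removes
      it.\<close>
    show ?thesis
      by (rule classifiedI[of "(mat 1, vector [q1, - p3])" S3_12])
         (auto simp: other_labels mem zero Ad_shift pq algebra_simps)
  next
    case (line v1 v2)
    have "v1\<^sup>2 + v2\<^sup>2 = 0" using invariant_line[OF S line(2), of 1 0 1] by (simp add: l)
    with line(1) show ?thesis by simp
  next
    case all
    then show ?thesis by (intro classified_subalg[of S5_2]) (auto simp: other_labels mem)
  qed
qed

lemma classified_solvable:
  assumes l: "lin S = {(x1, x2, x3). x3 = 0}"
  shows "classified S"
proof -
  have "(1, 0, 0) \<in> lin S" by (simp add: l)
  then obtain c1 p q where 1: "elt 1 0 0 c1 p q \<in> S" by (rule linE)
  have "(0, 1, 0) \<in> lin S" by (simp add: l)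
  then obtain c r s where 2: "elt 0 1 0 c r s \<in> S" by (rule linE)
  have b: "elt 1 0 0 0 (c1 / 2 * r - (c + 1) / 2 * p) (r + c1 / 2 * s - (c - 1) / 2 * q) \<in> S"
    using subalgebra_bracket[OF S 1 2] by simp
  have c1: "c1 = 0" using b unfolding lift[OF 1] by simp
  \<comment> \<open>The bracket of the lifts of \<open>e\<^sub>1\<close> and
    \<open>e\<^sub>2\<close> must agree with the lift of \<open>e\<^sub>1\<close> modulo
    translations. The factor \<open>c + 3\<close> measures the difference of the eigenvalues of
    \<open>f\<^sub>1\<close> and \<open>e\<^sub>1\<close>.\<close>
  have t: "(- (c + 3) / 2 * p, r - (c + 1) / 2 * q) \<in> trans_part S"
    using b unfolding lift[OF 1] by (simp add: c1 field_simps)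
  have "elt x1 x2 0 (c * x2) (p * x1 + r * x2) (q * x1 + s * x2) \<in> S" for x1 x2
    using subalgebra_add[OF S subalgebra_scale[OF S 1] subalgebra_scale[OF S 2], of x1 x2]
    by (simp add: c1 mult.commute)
  then have mem: "elt x1 x2 x3 x4 y1 y2 \<in> S \<longleftrightarrow> x3 = 0 \<and> x4 = c * x2 \<and>
      (y1 - (p * x1 + r * x2), y2 - (q * x1 + s * x2)) \<in> trans_part S"
    for x1 x2 x3 x4 y1 y2
    using mem_iff[of "\<lambda>_ x2 _. c * x2" "\<lambda>x1 x2 _. p * x1 + r * x2" "\<lambda>x1 x2 _. q * x1 + s * x2"]
    by (simp add: l)
  define a where "a = sgn p"
  have a: "p \<noteq> 0 \<Longrightarrow> a * p > 0" "p \<noteq> 0 \<Longrightarrow> a * a = 1" "p \<noteq> 0 \<Longrightarrow> a \<noteq> 0"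
    by (simp_all add: a_def sgn_real_def)
  have pa: "p \<noteq> 0 \<Longrightarrow> p / a = a * p"
    using a(2,3) by (simp add: field_simps)
  from S show ?thesis
  proof (cases rule: trans_part_cases)
    case zero
    then have t': "- (c + 3) / 2 * p = 0" "r - (c + 1) / 2 * q = 0"
      using t by (simp_all only: singleton_iff prod.inject)
    then have r: "r = (c + 1) / 2 * q" by (simp only: right_minus_eq)
    have "c + 3 = 0 \<or> p = 0" using t'(1) by (simp only: mult_eq_0_iff divide_eq_0_iff neg_equal_0_iff_equal) simp
    then have cp: "c = - 3 \<or> p = 0" by linarith
    \<comment> \<open>For \<open>c = 1\<close> the eigenvalue of \<open>f\<^sub>2\<close> vanishes,
      so the component \<open>s\<close> cannot be translated away and only its scale can be
      normalized.\<close>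
    consider "p = 0" "c \<noteq> 1" | "p = 0" "c = 1" "s = 0" | "p = 0" "c = 1" "s \<noteq> 0" | "p \<noteq> 0" "c = - 3"
      using cp by auto
    then show ?thesis
    proof cases
      case 1
      define u2 where "u2 = 2 * s / (c - 1)"
      then have u: "s = (c - 1) / 2 * u2" using 1 by simp
      show ?thesis
        by (rule classifiedI[of "(mat 1, vector [q, u2])" "S2_11 c"])
           (auto simp: other_labels mem zero Ad_shift 1 r u algebra_simps add_divide_distrib diff_divide_distrib)
    next
      case 2
      show ?thesis
        by (rule classifiedI[of "(mat 1, vector [q, 0])" "S2_11 1"])
           (use 2 in \<open>auto simp: other_labels mem zero Ad_shift r field_simps\<close>)
    next
      case 3
      show ?thesis
        by (rule classifiedI[of "(mat2 (1 / s) 0 0 (1 / s), vector [q / s, 0])" S2_12])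
           (use 3 in \<open>auto simp: square_pos_iff other_labels mem zero Ad_diag r field_simps\<close>)
    next
      case 4
      have H1: "a * y1 + x2 * (a * q) = a * p * x1 \<longleftrightarrow> y1 - (p * x1 + r * x2) = 0" for x1 x2 y1
      proof -
        have "a * y1 + x2 * (a * q) - a * p * x1 = a * (y1 - (p * x1 + r * x2))"
          by (simp add: r 4 algebra_simps)
        then show ?thesis using 4(1) a(3) by (metis mult_eq_0_iff right_minus_eq)
      qed
      have H2: "p * y2 - a * p * x1 * (a * q) - 2 * x2 * (p * s) / 2 = 0 \<longleftrightarrow> y2 - (q * x1 + s * x2) = 0" for x1 x2 y2
      proof -
        have "p * y2 - a * p * x1 * (a * q) - 2 * x2 * (p * s) / 2 = p * (y2 - (a * a * q * x1 + s * x2))"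
          by (simp add: algebra_simps)
        then show ?thesis using 4(1) a(2) by simp
      qed
      show ?thesis
        \<comment> \<open>As in the nilpotent case, \<open>a = sgn p\<close> makes the determinant
          positive. The second entry of the vector solves \<open>p s + 2 u2 = 0\<close>, as the
          eigenvalue of \<open>f\<^sub>2\<close> at \<open>c = - 3\<close> is
          \<open>- 2\<close>.\<close>
        by (rule classifiedI[of "(mat2 a 0 0 p, vector [a * q, - (p * s) / 2])" S2_13])
           (use 4 a(1,3) H1 H2 in \<open>auto simp: other_labels mem zero Ad_diag pa\<close>)
    qed
  next
    case (line v1 v2)
    have "v1 = 0" using invariant_line[OF S line(2), of 1 0 0] by (simp add: l)
    then have trans: "trans_part S = {(y1, y2). y1 = 0}" using line by auto
    then have "- (c + 3) / 2 * p = 0" using t by (simp only: mem_Collect_eq prod.case)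
    then have "c + 3 = 0 \<or> p = 0" by (simp only: mult_eq_0_iff divide_eq_0_iff neg_equal_0_iff_equal) simp
    then have cp: "c = - 3 \<or> p = 0" by linarith
    \<comment> \<open>Modulo \<open>f\<^sub>2\<close> only the eigenvalue \<open>(c + 1) / 2\<close>
      of \<open>f\<^sub>1\<close> matters, which vanishes at \<open>c = - 1\<close>.\<close>
    consider "p = 0" "c \<noteq> - 1" | "p = 0" "c = - 1" "r = 0" | "p = 0" "c = - 1" "r \<noteq> 0" | "p \<noteq> 0" "c = - 3"
      using cp by auto
    then show ?thesis
    proof cases
      case 1
      define u1 where "u1 = 2 * r / (c + 1)"
      have "c + 1 \<noteq> 0" using 1 by auto
      then have u: "r = (c + 1) / 2 * u1" by (simp add: u1_def)
      show ?thesis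
        by (rule classifiedI[of "(mat 1, vector [u1, 0])" "S3_8 c"])
           (auto simp: other_labels mem trans Ad_shift 1 u algebra_simps add_divide_distrib diff_divide_distrib)
    next
      case 2
      then show ?thesis
        by (intro classified_subalg[of "S3_8 (- 1)"]) (auto simp: other_labels mem trans)
    next
      case 3
      show ?thesis
        by (rule classifiedI[of "(mat2 (1 / r) 0 0 (1 / r), vector [0, 0])" S3_9])
           (use 3 in \<open>auto simp: square_pos_iff other_labels mem trans Ad_diag field_simps\<close>)
    next
      case 4
      have H1: "a * y1 - x2 * (a * r) = a * p * x1 \<longleftrightarrow> y1 = p * x1 + r * x2" for x1 x2 y1
      proof -
        have "a * y1 - x2 * (a * r) - a * p * x1 = a * (y1 - (p * x1 + r * x2))"
          by (simp add: algebra_simps)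
        then show ?thesis using 4(1) a(3) by (metis mult_eq_0_iff right_minus_eq)
      qed
      show ?thesis
        by (rule classifiedI[of "(mat2 a 0 0 p, vector [- (a * r), 0])" S3_10])
           (use 4 a(1,3) H1 in \<open>auto simp: other_labels mem trans Ad_diag pa\<close>)
    qed
  next
    case all
    then show ?thesis by (intro classified_subalg[of "S4_4 c"]) (auto simp: other_labels mem)
  qed
qed

text \<open>For \<open>c \<ge> 0\<close> the eigenvalue \<open>(c + 1) / 2\<close> of
  \<open>f\<^sub>1\<close> is nonzero, so the only resonance is that of \<open>f\<^sub>2\<close> at
  \<open>c = 1\<close>.\<close>

lemma classified_hyperbolic_nonneg:
  assumes l: "lin S = {(x1, x2, x3). x1 = 0 \<and> x3 = 0}" and 1: "elt 0 1 0 c p q \<in> S" and c: "c \<ge> 0"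
  shows "classified S"
proof -
  from subalgebra_scale[OF S 1]
  have mem: "elt x1 x2 x3 x4 y1 y2 \<in> S \<longleftrightarrow> x1 = 0 \<and> x3 = 0 \<and> x4 = c * x2 \<and>
      (y1 - p * x2, y2 - q * x2) \<in> trans_part S" for x1 x2 x3 x4 y1 y2
    using mem_iff[of "\<lambda>_ x _. c * x" "\<lambda>_ x _. p * x" "\<lambda>_ x _. q * x"] by (simp add: l mult.commute)
  have c1: "c + 1 \<noteq> 0" using c by simp
  from S show ?thesis
  proof (cases rule: trans_part_cases)
    case zero
    consider "c \<noteq> 1" | "c = 1" "q = 0" | "c = 1" "q \<noteq> 0" by blast
    then show ?thesis
    proof cases
      case 1
      define u1 u2 where "u1 = 2 * p / (c + 1)" and "u2 = 2 * q / (c - 1)"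
      then have u: "p = (c + 1) / 2 * u1" "q = (c - 1) / 2 * u2" using 1 c1 by simp_all
      show ?thesis
        by (rule classifiedI[of "(mat 1, vector [u1, u2])" "S1_4 c"])
           (use c in \<open>auto simp: parameters_labels mem zero Ad_shift u algebra_simps add_divide_distrib diff_divide_distrib\<close>)
    next
      case 2
      show ?thesis
        by (rule classifiedI[of "(mat 1, vector [p, 0])" "S1_4 1"])
           (use 2 in \<open>auto simp: parameters_labels mem zero Ad_shift field_simps\<close>)
    next
      case 3
      show ?thesis
        by (rule classifiedI[of "(mat2 (1 / q) 0 0 (1 / q), vector [p / q, 0])" S1_5])
           (use 3 in \<open>auto simp: square_pos_iff other_labels mem zero Ad_diag field_simps\<close>)
    qed
  next
    case (line v1 v2)
    have "v1 * v2 = 0" using invariant_line[OF S line(2), of 0 1 0] by (simp add: l)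
    then have "trans_part S = {(y1, y2). y2 = 0} \<or> trans_part S = {(y1, y2). y1 = 0}"
      using line by (cases "v1 = 0") auto
    moreover have "c = 0 \<or> c > 0" using c by linarith
    ultimately consider "trans_part S = {(y1, y2). y2 = 0}" "c \<noteq> 1"
      | "trans_part S = {(y1, y2). y2 = 0}" "c = 1" "q = 0"
      | "trans_part S = {(y1, y2). y2 = 0}" "c = 1" "q \<noteq> 0"
      | "trans_part S = {(y1, y2). y1 = 0}" "c > 0" | "trans_part S = {(y1, y2). y1 = 0}" "c = 0"
      by metis
    then show ?thesis
    proof cases
      case 1
      define u2 where "u2 = 2 * q / (c - 1)"
      then have u: "q = (c - 1) / 2 * u2" using 1 by simp
      show ?thesis
        by (rule classifiedI[of "(mat 1, vector [0, u2])" "S2_4 c"])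
           (use 1(1) c in \<open>auto simp: parameters_labels mem Ad_shift u algebra_simps add_divide_distrib diff_divide_distrib\<close>)
    next
      case 2
      then show ?thesis
        by (intro classified_subalg[of "S2_4 1"]) (auto simp: parameters_labels mem)
    next
      case 3
      show ?thesis
        by (rule classifiedI[of "(mat2 (1 / q) 0 0 (1 / q), vector [0, 0])" S2_6])
           (use 3 in \<open>auto simp: square_pos_iff other_labels mem Ad_diag field_simps\<close>)
    next
      case 4
      define u1 where "u1 = 2 * p / (c + 1)"
      then have u: "p = (c + 1) / 2 * u1" using c1 by simp
      show ?thesis
        by (rule classifiedI[of "(mat 1, vector [u1, 0])" "S2_5 c"])
           (use 4 in \<open>auto simp: parameters_labels mem Ad_shift u algebra_simps add_divide_distrib diff_divide_distrib\<close>)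
    next
      case 5
      \<comment> \<open>Since \<open>c = 0\<close>, the quarter turn keeps the parameter and moves
        the line of translations to the first axis, which explains the strict inequality in
        \<open>S2_5\<close>. The vector removes the remaining component \<open>p\<close>.\<close>
      show ?thesis
        by (rule classifiedI[of "(mat2 0 (- 1) 1 0, vector [0, 2 * p])" "S2_4 0"])
           (use 5 in \<open>auto simp: parameters_labels mem Ad_rotate\<close>)
    qed
  next
    case all
    then show ?thesis
      using c by (intro classified_subalg[of "S3_3 c"]) (auto simp: parameters_labels mem)
  qed
qed

end

lemma image_rotate:
  "elt x1 x2 x3 x4 y1 y2 \<in> Ad (mat2 0 (- 1) 1 0, vector [0, 0]) ` S \<longleftrightarrow> elt x3 (- x2) x1 x4 y2 (- y1) \<in> S"
proof
  assume "elt x1 x2 x3 x4 y1 y2 \<in> Ad (mat2 0 (- 1) 1 0, vector [0, 0]) ` S"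
  then obtain X where X: "elt x1 x2 x3 x4 y1 y2 = Ad (mat2 0 (- 1) 1 0, vector [0, 0]) X" "X \<in> S"
    by blast
  then show "elt x3 (- x2) x1 x4 y2 (- y1) \<in> S"
    by (cases X rule: elt_exhaust) (simp add: Ad_rotate)
next
  assume "elt x3 (- x2) x1 x4 y2 (- y1) \<in> S"
  from imageI[OF this, of "Ad (mat2 0 (- 1) 1 0, vector [0, 0])"]
  show "elt x1 x2 x3 x4 y1 y2 \<in> Ad (mat2 0 (- 1) 1 0, vector [0, 0]) ` S"
    by (simp add: Ad_rotate)
qed

text \<open>The quarter turn maps a lift of \<open>e\<^sub>2\<close> with trace \<open>c\<close> to
  one of \<open>- e\<^sub>2\<close>; after a change of sign the trace is \<open>- c\<close>. A
  second interpretation of the locale gives access to the nonnegative case for the rotated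
  subalgebra.\<close>

lemma (in dilation_free) classified_hyperbolic:
  assumes l: "lin S = {(x1, x2, x3). x1 = 0 \<and> x3 = 0}"
  shows "classified S"
proof -
  have "(0, 1, 0) \<in> lin S" by (simp add: l)
  then obtain c p q where 1: "elt 0 1 0 c p q \<in> S" by (rule linE)
  show ?thesis
  proof (cases "c \<ge> 0")
    case True
    with l 1 show ?thesis by (rule classified_hyperbolic_nonneg)
  next
    case False
    define T where "T = Ad (mat2 0 (- 1) 1 0, vector [0, 0]) ` S"
    have mem: "elt x1 x2 x3 x4 y1 y2 \<in> T \<longleftrightarrow> elt x3 (- x2) x1 x4 y2 (- y1) \<in> S" for x1 x2 x3 x4 y1 y2
      unfolding T_def by (rule image_rotate)
    have T: "subalgebra T" unfolding T_def by (rule subalgebra_Ad[OF _ S]) simp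
    interpret T: dilation_free T
      by unfold_locales (use T no_dilation in \<open>auto simp: mem\<close>)
    have "(x1, x2, x3) \<in> lin T \<longleftrightarrow> (x3, - x2, x1) \<in> lin S" for x1 x2 x3
    proof -
      have "(\<exists>y1 y2. elt x3 (- x2) x1 x4 y2 (- y1) \<in> S) \<longleftrightarrow> (\<exists>y1 y2. elt x3 (- x2) x1 x4 y1 y2 \<in> S)" for x4
        by (metis minus_minus)
      then show ?thesis by (simp add: lin_def mem)
    qed
    then have "lin T = {(x1, x2, x3). x1 = 0 \<and> x3 = 0}" by (auto simp: l)
    moreover have "elt 0 1 0 (- c) q (- p) \<in> T"
      using subalgebra_scale[OF S 1, of "- 1"] by (simp add: mem)
    ultimately have "classified T" using False by (intro T.classified_hyperbolic_nonneg) auto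
    then show ?thesis
      unfolding T_def by (rule classified_Ad[rotated]) simp
  qed
qed

section \<open>Completeness of the list\<close>

lemma classified_proper_subalgebra:
  assumes "proper_subalgebra S" shows "classified S"
proof -
  have S: "subalgebra S" "S \<noteq> {0}" "S \<noteq> UNIV"
    using assms by (auto simp: proper_subalgebra_def)
  obtain p where p: "p \<in> aff_group"
    and lin: "lin (Ad p ` S) \<in> {{(0, 0, 0)}, {(x1, x2, x3). x2 = 0 \<and> x3 = 0}, {(x1, x2, x3). x1 = 0 \<and> x3 = 0},
      {(x1, x2, x3). x2 = 0 \<and> x3 = x1}, {(x1, x2, x3). x3 = 0}, UNIV}"
    using lin_normal_form[OF S(1)] .
  have proper: "Ad p ` S \<noteq> {0}" "Ad p ` S \<noteq> UNIV" if p: "p \<in> aff_group" and S: "S \<noteq> {0}" "S \<noteq> UNIV" for p S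
  proof -
    obtain q where q: "\<And>X. Ad q (Ad p X) = X" using Ad_inverse[OF p] by metis
    then have "S = Ad q ` Ad p ` S" by (simp add: image_image)
    moreover have "Ad q ` {0} = {0}" by (simp add: linear_0[OF linear_Ad])
    moreover have "Ad q ` UNIV = UNIV" using q by (metis surjI)
    ultimately show "Ad p ` S \<noteq> {0}" "Ad p ` S \<noteq> UNIV" using S by metis+
  qed
  define T where "T = Ad p ` S"
  have T: "subalgebra T" "T \<noteq> {0}" "T \<noteq> UNIV"
    using subalgebra_Ad[OF p S(1)] proper[OF p S(2,3)] by (simp_all add: T_def)
  note lin' = lin[folded T_def]
  have "classified T"
  proof (cases "\<exists>x4 y1 y2. elt 0 0 0 x4 y1 y2 \<in> T \<and> x4 \<noteq> 0")
    case True
    then obtain x4 y1 y2 where "elt 0 0 0 x4 y1 y2 \<in> T" "x4 \<noteq> 0" by blast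
    then have "elt 0 0 0 1 (y1 / x4) (y2 / x4) \<in> T"
      using subalgebra_scale[OF T(1), of "elt 0 0 0 x4 y1 y2" "1 / x4"] by simp
    \<comment> \<open>A translation by \<open>u\<close> subtracts \<open>u / 2\<close> from the
      translational part of an element with linear part that of \<open>e\<^sub>4\<close>; hence the
      factor 2. It moves the centre of the dilation to the origin without changing
      \<open>lin T\<close>.\<close>
    from imageI[OF this, of "Ad (mat 1, vector [2 * (y1 / x4), 2 * (y2 / x4)])"]
    have "elt 0 0 0 1 0 0 \<in> Ad (mat 1, vector [2 * (y1 / x4), 2 * (y2 / x4)]) ` T"
      by (simp add: Ad_shift)
    then have "classified (Ad (mat 1, vector [2 * (y1 / x4), 2 * (y2 / x4)]) ` T)"
      by (rule classified_dilation[rotated])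
         (use T proper lin' in \<open>simp_all only: lin_shift shift_in_aff_group subalgebra_Ad simp_thms\<close>)
    then show ?thesis by (rule classified_Ad[rotated]) simp
  next
    case False
    interpret dilation_free T
      by unfold_locales (use T(1) False in auto)
    from lin' show ?thesis
      using classified_trivial[OF _ T(2)] classified_nilpotent classified_hyperbolic
        classified_elliptic classified_solvable classified_simple
      by (elim insertE emptyE)
  qed
  then show ?thesis unfolding T_def by (rule classified_Ad[OF p])
qed

theorem theorem11:
  shows "(\<forall>l\<in>labels. proper_subalgebra (subalg l))
    \<and> (\<forall>l\<in>labels_1D. dim (subalg l) = 1)
    \<and> (\<forall>l\<in>labels_2D. dim (subalg l) = 2)
    \<and> (\<forall>l\<in>labels_3D. dim (subalg l) = 3)
    \<and> (\<forall>l\<in>labels_4D. dim (subalg l) = 4)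
    \<and> (\<forall>l\<in>labels_5D. dim (subalg l) = 5)
    \<and> (\<forall>S. proper_subalgebra S \<longrightarrow> (\<exists>!l. l \<in> labels \<and> equivalent S (subalg l)))"
proof (intro conjI ballI allI impI)
  fix S assume "proper_subalgebra S"
  then obtain l where l: "l \<in> labels" "equivalent S (subalg l)"
    using classified_proper_subalgebra unfolding classified_def by blast
  show "\<exists>!l. l \<in> labels \<and> equivalent S (subalg l)"
  proof (rule ex1I[of _ l])
    fix l' assume "l' \<in> labels \<and> equivalent S (subalg l')"
    then show "l' = l"
      using l labels_inequivalent[of l' l] equivalent_sym equivalent_trans by blast
  qed (use l in simp)
qed (simp_all add: proper_subalgebra_subalg dim_subalg)

end
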